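(* Let $(X,Y)=(X_n,Y_n)_{n\in\mathbb{T}}$, $\mathbb{T}=\{0,-1,-2,\dots\}$, be the hidden Markov model on $(\Omega,\mathcal{F},\mathbf{P})$ described in the context, with conditional kernels $M^y=(M_n^y)_{n\in\mathbb{T}}$, and let $\mathbf{Q}^y$, $(T_n)_{n\in\mathbb{T}}$, $\mathbf{P}^{\mathcal{F}^Y}$ and $\mathbf{P}_{\pi^y}$ be as defined there. The following are equivalent: 1. $\mathbf{Q}^{Y(\omega)}\big(\bigcap_{n\in\mathbb{T}}\{T_n>-\infty\}\big)=1$ for $\mathbf{P}$-almost all $\omega$. 2. There exists a set $H\in\mathcal{F}$ such that $\mathbf{P}(H)=1$ and $$\mathbf{P}^{\mathcal{F}^Y}(\omega,A)=\mathbf{P}^{\mathcal{F}^Y}(\omega,A)^2=\mathbf{P}_{\pi^{Y(\omega)}}(A)$$ for all $\omega\in H$, $A\in\bigcap_{n\in\mathbb{T}}\mathcal{F}^X_{]-\infty,n]}$ and $\pi^{Y(\omega)}\in\Pi_{M^{Y(\omega)}}$.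
   Context: Absolute probabilities: for a sequence $K=(K_n)_{n\in\mathbb{T}}$ of Markov kernels on $E$, $\Pi_K$ is the (always non-empty) set of families $(\pi_n)_{n\in\mathbb{T}}$ of probability distributions on $E$ with $\sum_{z}\pi_{n-1}(z)K_n(z,x)=\pi_n(x)$ for all $n\in\mathbb{T}$, $x\in E$. Model: $E=\{1,\dots,s\}$ is finite; $F$ is a non-empty Polish space with Borel $\sigma$-algebra $\mathcal{B}(F)$; $\Omega^X=E^{\mathbb{T}}$, $\Omega^Y=F^{\mathbb{T}}$ with product $\sigma$-algebras; $\Omega=\Omega^X\times\Omega^Y$ with Borel $\sigma$-algebra $\mathcal{F}$. $\tilde X_n:\Omega^X\to E$ and $\tilde Y_n:\Omega^Y\to F$ are the coordinate maps; $X_n(x,y)=x_n$, $Y_n(x,y)=y_n$ on $\Omega$; $X=(X_n)_{n\in\mathbb{T}}$, $Y=(Y_n)_{n\in\mathbb{T}}$. For $I\subset\mathbb{T}$, $\mathcal{F}^X_I=\sigma(X_n;n\in I)$, $\mathcal{F}^{\tilde X}_I=\sigma(\tilde X_n;n\in I)$, $\mathcal{F}^Y_I=\sigma(Y_n;n\in I)$, $\mathcal{F}^{\tilde Y}_I=\sigma(\tilde Y_n;n\in I)$; omission of $I$ means $I=\mathbb{T}$. $M=(M_n)_{n\in\mathbb{T}}$ are Markov kernels on $E$, $G_n(x,dy)=g_n(x,y)\psi(dy)$, $n\in\mathbb{T}$, are probability kernels from $E$ to $F$ with $g_n:E\times F\to[0,\infty[$ and $\psi$ a $\sigma$-finite measure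 on $F$, and $\pi\in\Pi_M$ is fixed. $\mathbf{P}$ is the probability measure on $(\Omega,\mathcal{F})$ under which, for each $n\in\mathbb{T}$, $(X_n,Y_n,\dots,X_0,Y_0)$ has law $\pi_n(dx_n)G_n(x_n,dy_n)\prod_{k=n+1}^0M_k(x_{k-1},dx_k)G_k(x_k,dy_k)$. Conditional kernels: let $\phi_1\equiv1$ and, for $n\in\mathbb{T}$, $\phi_n(x,y_{n:0})=\sum_{x'\in E}M_n(x,x')g_n(x',y_n)\phi_{n+1}(x',y_{n+1:0})$, where $y_{n:0}=(y_n,\dots,y_0)$. For $y\in\Omega^Y$, $M_n^y(x,x')=M_n(x,x')g_n(x',y_n)\phi_{n+1}(x',y_{n+1:0})/\phi_n(x,y_{n:0})$ if $\phi_n(x,y_{n:0})>0$, and $M_n^y(x,x')=M_n(x,x')$ if $\phi_n(x,y_{n:0})=0$. Coupling: on $(E^s)^{\mathbb{T}}$ with product $\sigma$-algebra and coordinates $(\xi_n^x;x\in E,n\in\mathbb{T})$, $\mathbf{Q}^y$ (a probability kernel in $y\in\Omega^Y$) makes all $\xi_n^x$ independent with $\mathbf{Q}^y(\xi_n^x=x')=M_n^y(x,x')$. $\Phi_n(x)=\xi_n^x$; $\Phi_{n,k}=\Phi_k\circ\cdots\circ\Phi_{n+1}$ for $n<k$; $T_k=\sup\{n<k:\text{image of }\Phi_{n,k}\text{ is a singleton}\}$, with $T_k=-\infty$ if this set is empty. Conditional law of the signal: there exist probability kernels $\mu_n:\Omega^Y\times E\to[0,1]$, $n\in\mathbb{T}$,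 such that for all $x\in E$, $\mathbf{P}(X_n=x|\mathcal{F}^Y)=\mu_n^Y(x)$ and $\sum_{x'}\mu_{n-1}^Y(x')M_n^Y(x',x)=\mu_n^Y(x)$, $\mathbf{P}$-a.s.; there exist also a probability kernel $P^{\cdot}(\cdot):\Omega^Y\times\mathcal{F}^{\tilde X}\to[0,1]$ and $\tilde H\in\mathcal{F}^{\tilde Y}$ with $\mathbf{P}(Y\in\tilde H)=1$ such that for all $y\in\tilde H$, $n\in\mathbb{T}$ and $x_n,\dots,x_0\in E$, $P^y(\tilde X_n=x_n,\dots,\tilde X_0=x_0)=\mu_n^y(x_n)\prod_{k=n+1}^0M_k^y(x_{k-1},x_k)$. Fix such choices. Every set in $\mathcal{F}^X$ is of the form $A\times\Omega^Y$ with $A\in\mathcal{F}^{\tilde X}$, and $\mathbf{P}^{\mathcal{F}^Y}:\Omega\times\mathcal{F}^X\to[0,1]$ is defined by $\mathbf{P}^{\mathcal{F}^Y}(\omega,A\times\Omega^Y)=P^{Y(\omega)}(A)$; it is a version of $\mathbf{P}(\cdot|\mathcal{F}^Y)$ on $\mathcal{F}^X$. For $y\in\Omega^Y$ and $\pi^y\in\Pi_{M^y}$, $P_{\pi^y}$ is the probability measure on $\mathcal{F}^{\tilde X}$ with $P_{\pi^y}(\tilde X_n=x_n,\dots,\tilde X_0=x_0)=\pi^y_n(x_n)\prod_{k=n+1}^0M^y_k(x_{k-1},x_k)$ for all $n\in\mathbb{T}$, and $\mathbf{P}_{\pi^y}(A\times\Omega^Y)=P_{\pi^y}(A)$, $A\in\mathcal{F}^{\tilde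 X}$, defines a probability measure on $\mathcal{F}^X$. *)

theory Defs
  imports "HOL-Probability.Probability"
begin

text \<open>
  The time set \<open>{0, -1, -2, \<dots>}\<close> is \<open>{..0::int}\<close>; families indexed by it are functions on \<^typ>\<open>int\<close>
  whose values at positive times are never used (the path spaces consist of extensional functions).
  The state space \<open>E\<close> is a type of class \<^class>\<open>finite\<close>, the observation space \<open>F\<close> a type of class
  \<^class>\<open>polish_space\<close>. Distributions on \<open>E\<close> are of type \<open>'e pmf\<close>, Markov kernels on \<open>E\<close> of type
  \<open>'e \<Rightarrow> 'e pmf\<close>.
\<close>

definition absolute_probs :: "(int \<Rightarrow> 'e::finite \<Rightarrow> 'e pmf) \<Rightarrow> (int \<Rightarrow> 'e pmf) set" where
  "absolute_probs K =
     {p. \<forall>n\<le>0. \<forall>x. (\<Sum>z\<in>UNIV. pmf (p (n - 1)) z * pmf (K n z) x) = pmf (p n) x}"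


subsection \<open>Path spaces\<close>

definition OmegaX :: "(int \<Rightarrow> 'e::finite) measure" where
  "OmegaX = PiM {..0} (\<lambda>_. count_space UNIV)"

definition OmegaY :: "(int \<Rightarrow> 'f::polish_space) measure" where
  "OmegaY = PiM {..0} (\<lambda>_. borel)"

text \<open>As \<open>E\<close> and \<open>F\<close> are second countable, the Borel \<open>\<sigma>\<close>-algebra is the product \<open>\<sigma>\<close>-algebra.\<close>

definition Omega :: "((int \<Rightarrow> 'e::finite) \<times> (int \<Rightarrow> 'f::polish_space)) measure" where
  "Omega = OmegaX \<Otimes>\<^sub>M OmegaY"

definition coordX :: "int \<Rightarrow> (int \<Rightarrow> 'e) \<times> (int \<Rightarrow> 'f) \<Rightarrow> 'e" where
  "coordX n \<omega> = fst \<omega> n"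

definition coordY :: "int \<Rightarrow> (int \<Rightarrow> 'e) \<times> (int \<Rightarrow> 'f) \<Rightarrow> 'f" where
  "coordY n \<omega> = snd \<omega> n"

definition generated_algebra ::
    "'w set \<Rightarrow> ('i \<Rightarrow> 'w \<Rightarrow> 'v) \<Rightarrow> 'v measure \<Rightarrow> 'i set \<Rightarrow> 'w measure" where
  "generated_algebra W Z N I = sigma W (\<Union>i\<in>I. {Z i -` B \<inter> W | B. B \<in> sets N})"

definition algX :: "int set \<Rightarrow> ((int \<Rightarrow> 'e::finite) \<times> (int \<Rightarrow> 'f::polish_space)) measure" where
  "algX I = generated_algebra (space Omega) coordX (count_space UNIV) I"

definition algY :: "int set \<Rightarrow> ((int \<Rightarrow> 'e::finite) \<times> (int \<Rightarrow> 'f::polish_space)) measure" where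
  "algY I = generated_algebra (space Omega) coordY borel I"


subsection \<open>The hidden Markov model\<close>

definition obs_kernel :: "(int \<Rightarrow> 'e \<Rightarrow> 'f \<Rightarrow> real) \<Rightarrow> 'f measure \<Rightarrow> int \<Rightarrow> 'e \<Rightarrow> 'f measure" where
  "obs_kernel g \<psi> n x = density \<psi> (\<lambda>y. ennreal (g n x y))"

text \<open>
  Since \<open>E\<close> is finite, the law
  \<open>p\<^sub>n(dx\<^sub>n) G\<^sub>n(x\<^sub>n,dy\<^sub>n) \<Prod>\<^sub>k M\<^sub>k(x\<^bsub>k-1\<^esub>,dx\<^sub>k) G\<^sub>k(x\<^sub>k,dy\<^sub>k)\<close> of
  \<open>(X\<^sub>n, Y\<^sub>n, \<dots>, X\<^sub>0, Y\<^sub>0)\<close> is given by its values on the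
  rectangles \<open>{x\<^sub>n} \<times> B\<^sub>n \<times> \<dots> \<times> {x\<^sub>0} \<times> B\<^sub>0\<close>.
\<close>

definition hmm_law ::
    "(int \<Rightarrow> 'e::finite \<Rightarrow> 'e pmf) \<Rightarrow> (int \<Rightarrow> 'e \<Rightarrow> 'f::polish_space \<Rightarrow> real) \<Rightarrow> 'f measure \<Rightarrow>
     (int \<Rightarrow> 'e pmf) \<Rightarrow> ((int \<Rightarrow> 'e) \<times> (int \<Rightarrow> 'f)) measure \<Rightarrow> bool" where
  "hmm_law M g \<psi> p P \<longleftrightarrow>
     prob_space P \<and> sets P = sets Omega \<and>
     (\<forall>n\<le>0. \<forall>x B. (\<forall>k\<in>{n..0}. B k \<in> sets borel) \<longrightarrow>
        measure P {\<omega> \<in> space P. \<forall>k\<in>{n..0}. coordX k \<omega> = x k \<and> coordY k \<omega> \<in> B k} =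
          pmf (p n) (x n) * measure (obs_kernel g \<psi> n (x n)) (B n) *
          (\<Prod>k\<in>{n+1..0}. pmf (M k (x (k - 1))) (x k) * measure (obs_kernel g \<psi> k (x k)) (B k)))"


subsection \<open>Conditional kernels\<close>

function phi ::
    "(int \<Rightarrow> 'e::finite \<Rightarrow> 'e pmf) \<Rightarrow> (int \<Rightarrow> 'e \<Rightarrow> 'f \<Rightarrow> real) \<Rightarrow> int \<Rightarrow> 'e \<Rightarrow> (int \<Rightarrow> 'f) \<Rightarrow> real" where
  "phi M g n x y =
     (if n \<le> 0 then (\<Sum>x'\<in>UNIV. pmf (M n x) x' * g n x' (y n) * phi M g (n + 1) x' y) else 1)"
  by pat_completeness auto
termination
  by (relation "Wellfounded.measure (\<lambda>(_, _, n, _, _). nat (1 - n))") auto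

declare phi.simps [simp del]

text \<open>
  The argument of \<^const>\<open>embed_pmf\<close> is a probability mass function whenever \<open>g \<ge> 0\<close>, see
  \<open>pmf_cond_kernel\<close> below.
\<close>

definition cond_kernel ::
    "(int \<Rightarrow> 'e::finite \<Rightarrow> 'e pmf) \<Rightarrow> (int \<Rightarrow> 'e \<Rightarrow> 'f \<Rightarrow> real) \<Rightarrow> (int \<Rightarrow> 'f) \<Rightarrow> int \<Rightarrow> 'e \<Rightarrow> 'e pmf" where
  "cond_kernel M g y n x =
     (if phi M g n x y > 0
      then embed_pmf (\<lambda>x'. pmf (M n x) x' * g n x' (y n) * phi M g (n + 1) x' y / phi M g n x y)
      else M n x)"

lemma phi_nonneg:
  assumes "\<And>n x z. n \<le> 0 \<Longrightarrow> 0 \<le> g n x z"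
  shows "0 \<le> phi M g n x y"
  using assms
proof (induction M g n x y rule: phi.induct)
  case (1 M g n x y)
  then show ?case
    by (subst phi.simps) (auto intro!: sum_nonneg mult_nonneg_nonneg)
qed

lemma pmf_cond_kernel:
  assumes "\<And>n x z. n \<le> 0 \<Longrightarrow> 0 \<le> g n x z" and "n \<le> 0"
  shows "pmf (cond_kernel M g y n x) x' =
    (if phi M g n x y > 0
     then pmf (M n x) x' * g n x' (y n) * phi M g (n + 1) x' y / phi M g n x y
     else pmf (M n x) x')"
proof (cases "phi M g n x y > 0")
  case True
  let ?f = "\<lambda>x'. pmf (M n x) x' * g n x' (y n) * phi M g (n + 1) x' y / phi M g n x y"
  have nonneg: "0 \<le> ?f z" for z
    using True assms by (auto intro!: divide_nonneg_nonneg mult_nonneg_nonneg phi_nonneg)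
  have "sum ?f UNIV = phi M g n x y / phi M g n x y"
    using \<open>n \<le> 0\<close> by (subst (3) phi.simps) (simp add: sum_divide_distrib)
  with True have "sum ?f UNIV = 1"
    by simp
  then have "(\<integral>\<^sup>+z. ennreal (?f z) \<partial>count_space UNIV) = 1"
    using nonneg by (simp add: nn_integral_count_space_finite sum_ennreal)
  with True nonneg show ?thesis
    by (simp add: cond_kernel_def pmf_embed_pmf)
qed (simp add: cond_kernel_def)


subsection \<open>The coupling\<close>

text \<open>
  A point \<open>\<xi>\<close> of \<open>(E\<^sup>s)\<^sup>T\<close> has coordinates \<open>\<xi> n x\<close>, so that the random map \<open>\<Phi>\<^sub>n\<close> is \<open>\<xi> n\<close> itself.
  Under the product measure all coordinates are independent.
\<close>

definition coupling :: "(int \<Rightarrow> 'e::finite \<Rightarrow> 'e pmf) \<Rightarrow> (int \<Rightarrow> 'e \<Rightarrow> 'e) measure" where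
  "coupling K = PiM {..0} (\<lambda>n. PiM UNIV (\<lambda>x. measure_pmf (K n x)))"

text \<open>\<open>flow \<xi> n k = \<xi> k \<circ> \<dots> \<circ> \<xi> (n + 1)\<close>\<close>

definition flow :: "(int \<Rightarrow> 'e \<Rightarrow> 'e) \<Rightarrow> int \<Rightarrow> int \<Rightarrow> 'e \<Rightarrow> 'e" where
  "flow \<xi> n k = fold (\<lambda>m f. \<xi> m \<circ> f) [n+1..k] id"

text \<open>The supremum is taken in \<^typ>\<open>ereal\<close>, where the supremum of the empty set is \<open>-\<infinity>\<close>.\<close>

definition coalescence_time :: "int \<Rightarrow> (int \<Rightarrow> 'e \<Rightarrow> 'e) \<Rightarrow> ereal" where
  "coalescence_time k \<xi> = Sup ((\<lambda>n. ereal (of_int n)) ` {n. n < k \<and> is_singleton (range (flow \<xi> n k))})"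


subsection \<open>Laws of Markov chains\<close>

definition markov_fdd ::
    "(int \<Rightarrow> 'e::finite \<Rightarrow> 'e pmf) \<Rightarrow> (int \<Rightarrow> 'e pmf) \<Rightarrow> (int \<Rightarrow> 'e) measure \<Rightarrow> bool" where
  "markov_fdd K p Q \<longleftrightarrow>
     (\<forall>n\<le>0. \<forall>x. measure Q {\<xi> \<in> space OmegaX. \<forall>k\<in>{n..0}. \<xi> k = x k} =
        pmf (p n) (x n) * (\<Prod>k\<in>{n+1..0}. pmf (K k (x (k - 1))) (x k)))"

text \<open>
  Existence of this measure for \<open>p \<in> absolute_probs K\<close> is Kolmogorov's extension theorem; it is
  unique because the cylinder sets form a generating \<open>\<inter>\<close>-stable class.
\<close>

definition markov_law ::
    "(int \<Rightarrow> 'e::finite \<Rightarrow> 'e pmf) \<Rightarrow> (int \<Rightarrow> 'e pmf) \<Rightarrow> (int \<Rightarrow> 'e) measure" where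
  "markov_law K p = (THE Q. prob_space Q \<and> sets Q = sets OmegaX \<and> markov_fdd K p Q)"

text \<open>
  Every set of \<open>algX {..0}\<close> has the form \<open>A = B \<times> \<Omega>\<^sup>Y\<close>, with \<open>B = fst ` A\<close>; a measure \<open>Q\<close>
  on \<open>\<Omega>\<^sup>X\<close> assigns to \<open>A\<close> the value \<open>Q B\<close>.
\<close>

definition lifted_prob ::
    "(int \<Rightarrow> 'e::finite) measure \<Rightarrow> ((int \<Rightarrow> 'e) \<times> (int \<Rightarrow> 'f::polish_space)) set \<Rightarrow> real" where
  "lifted_prob Q A = measure Q (fst ` A)"

lemma lifted_prob_Times:
  "lifted_prob Q (B \<times> space (OmegaY :: (int \<Rightarrow> 'f::polish_space) measure)) = measure Q B"
proof -
  have "space (OmegaY :: (int \<Rightarrow> 'f) measure) \<noteq> {}"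
    by (simp add: OmegaY_def space_PiM PiE_eq_empty_iff)
  then show ?thesis
    by (simp add: lifted_prob_def)
qed

end

theory Submission
  imports Defs "HOL-Complex_Analysis.Great_Picard"
begin

text \<open>
  Once the observation path \<open>y\<close> is fixed, nothing is left of the hidden Markov model but one sequence
  \<open>K = M\<^sup>y\<close> of Markov kernels on a finite set of \<open>s\<close> states. For almost every \<open>y\<close> the conditional law of the
  signal is the law of a Markov chain with kernels \<open>K\<close>. The theorem follows from a statement about an arbitrary
  sequence \<open>K\<close>, lemma \<open>coalescing_iff_tail\<close>, and the pivot is a third condition that does not mention the
  coupling or the tail: absolute probabilities for \<open>K\<close> are unique.

  Coalescence implies uniqueness by the coupling inequality: if all trajectories that start at time \<open>n\<close> have
  merged at time \<open>k\<close>, the law at time \<open>k\<close> does not depend on the law at time \<open>n\<close>. Conversely, by compactness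
  uniqueness makes the rows of the transition matrices from \<open>m\<close> to \<open>n\<close> approach each other as \<open>m\<close> tends to
  \<open>-\<infinity>\<close>. Two trajectories of the coupling are independent until they meet. If the rows agree up to
  \<open>1 / (2 s)\<close>, the two trajectories have met at time \<open>n\<close> with probability at least \<open>1 / (2 s)\<close>; as this
  applies along infinitely many disjoint stretches of time, no pair can stay apart
  (\<open>unmerged_contraction\<close>, \<open>unmerged_tendsto_0\<close>).

  Uniqueness implies that the tail is trivial, because a Markov law conditioned on a tail event is a Markov law
  for the same kernels (\<open>conditioned_on_tail_is_markov_law\<close>). Conversely, two Markov laws with the same
  kernels that agree on the tail are equal (\<open>markov_laws_agree_if_agree_on_tail\<close>): their difference attains its
  total variation already on events of the past of \<open>m\<close>, for every \<open>m\<close>, since the common kernels create no further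
  difference after time \<open>m\<close>; the limit superior of such maximizing events is a tail event that also attains the
  total variation. So if all Markov laws for \<open>K\<close> agree with the conditional law on the tail, there is only one
  family of absolute probabilities. That every family belongs to a Markov law is shown by constructing the
  reversed chain (\<open>markov_law_exists\<close>).
\<close>

section \<open>Absolute probabilities and transition probabilities\<close>

lemma pmf_bind_finite:
  fixes r :: "'e::finite pmf"
  shows "pmf (bind_pmf r f) z = (\<Sum>x\<in>UNIV. pmf r x * pmf (f x) z)"
  by (simp add: pmf_bind integral_measure_pmf[of UNIV])

lemma sum_pmf_UNIV: "(\<Sum>x\<in>UNIV. pmf (r :: 'e::finite pmf) x) = 1"
  by (simp add: sum_pmf_eq_1)

lemma absolute_probs_iff:
  "q \<in> absolute_probs K \<longleftrightarrow> (\<forall>n\<le>0. bind_pmf (q (n - 1)) (K n) = q n)"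
  by (auto simp: absolute_probs_def pmf_eq_iff pmf_bind_finite)

definition transition :: "(int \<Rightarrow> 'e::finite \<Rightarrow> 'e pmf) \<Rightarrow> int \<Rightarrow> int \<Rightarrow> 'e \<Rightarrow> 'e pmf" where
  "transition K n k x = fold (\<lambda>m r. bind_pmf r (K m)) [n+1..k] (return_pmf x)"

lemma transition_refl [simp]: "transition K n n x = return_pmf x"
  by (simp add: transition_def)

lemma transition_last:
  "n < k \<Longrightarrow> transition K n k x = bind_pmf (transition K n (k - 1) x) (K k)"
  by (simp add: transition_def upto_rec2)

text \<open>
  Binding is associative, so a composition of kernels can be peeled off at its first factor although the
  fold in \<open>transition\<close> accumulates at the last one.
\<close>

lemma fold_bind_pmf:
  "fold (\<lambda>m r. bind_pmf r (K m)) ms r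
     = bind_pmf r (\<lambda>x. fold (\<lambda>m r. bind_pmf r (K m)) ms (return_pmf x))"
proof (induction ms arbitrary: r)
  case Nil
  show ?case by (simp add: bind_return_pmf')
next
  case (Cons m ms)
  show ?case
    by (subst (1 2) fold_Cons, unfold o_apply, subst (1 2) Cons.IH)
      (simp add: bind_assoc_pmf bind_return_pmf)
qed

lemma transition_first:
  "n < k \<Longrightarrow> transition K n k x = bind_pmf (K (n + 1) x) (transition K (n + 1) k)"
  by (subst transition_def, subst upto_rec1, simp, subst fold_Cons, unfold o_apply,
      subst fold_bind_pmf) (simp add: bind_return_pmf transition_def[abs_def])

lemma absolute_probs_transition:
  assumes "q \<in> absolute_probs K" "n \<le> k" "k \<le> 0"
  shows "q k = bind_pmf (q n) (transition K n k)"
  using assms(2,3)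
proof (induction k rule: int_ge_induct)
  case base
  show ?case by (simp add: bind_return_pmf')
next
  case (step k)
  have "q (k + 1) = bind_pmf (q k) (K (k + 1))"
    using assms(1) step.prems by (simp add: absolute_probs_iff) (metis add_diff_cancel_right')
  with step show ?case
    by (simp add: transition_last bind_assoc_pmf)
qed

section \<open>Uniqueness of absolute probabilities and weak ergodicity\<close>

text \<open>
  Only non-positive times are compared: membership in \<^const>\<open>absolute_probs\<close> says nothing about the values
  at positive times.
\<close>

definition unique_absolute_probs :: "(int \<Rightarrow> 'e::finite \<Rightarrow> 'e pmf) \<Rightarrow> bool" where
  "unique_absolute_probs K \<longleftrightarrow>
     (\<forall>q\<in>absolute_probs K. \<forall>q'\<in>absolute_probs K. \<forall>n\<le>0. q n = q' n)"

text \<open>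
  If chains are started further and further in the past, the recursion that defines absolute probabilities
  holds for their one-time laws from the starting time on, hence for all times in the limit.
\<close>

lemma limit_of_transitions_absolute:
  fixes K :: "int \<Rightarrow> 'e::finite \<Rightarrow> 'e pmf"
  assumes N: "filterlim N at_bot sequentially"
    and L: "\<And>m z. m \<le> 0 \<Longrightarrow> (\<lambda>j. pmf (transition K (N j) m (X j)) z) \<longlonglongrightarrow> L m z"
  shows "(\<lambda>m. embed_pmf (L m)) \<in> absolute_probs K"
    and "m \<le> 0 \<Longrightarrow> pmf (embed_pmf (L m)) z = L m z"
proof -
  have nonneg: "0 \<le> L m z" if "m \<le> 0" for m z
    using L[OF that] by (rule LIMSEQ_le_const) (simp add: pmf_nonneg)
  have sum1: "(\<Sum>z\<in>UNIV. L m z) = 1" if "m \<le> 0" for m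
  proof -
    have "(\<lambda>j. \<Sum>z\<in>UNIV. pmf (transition K (N j) m (X j)) z) \<longlonglongrightarrow> (\<Sum>z\<in>UNIV. L m z)"
      by (intro tendsto_sum L that)
    then show ?thesis
      by (simp add: sum_pmf_UNIV LIMSEQ_const_iff)
  qed
  show pmf_L: "pmf (embed_pmf (L m)) z = L m z" if "m \<le> 0" for m z
    using nonneg[OF that] sum1[OF that]
    by (intro pmf_embed_pmf) (auto simp: nn_integral_count_space_finite sum_ennreal)
  have step: "(\<Sum>x\<in>UNIV. L (m - 1) x * pmf (K m x) z) = L m z" if "m \<le> 0" for m z
  proof -
    have "(\<lambda>j. \<Sum>x\<in>UNIV. pmf (transition K (N j) (m - 1) (X j)) x * pmf (K m x) z)
        \<longlonglongrightarrow> (\<Sum>x\<in>UNIV. L (m - 1) x * pmf (K m x) z)"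
      using that by (intro tendsto_sum tendsto_mult L tendsto_const) auto
    moreover have "eventually (\<lambda>j. N j \<le> m - 1) sequentially"
      using N unfolding filterlim_at_bot by blast
    then have "eventually (\<lambda>j. (\<Sum>x\<in>UNIV. pmf (transition K (N j) (m - 1) (X j)) x * pmf (K m x) z)
        = pmf (transition K (N j) m (X j)) z) sequentially"
      by eventually_elim (simp add: transition_last pmf_bind_finite)
    ultimately have "(\<lambda>j. pmf (transition K (N j) m (X j)) z)
        \<longlonglongrightarrow> (\<Sum>x\<in>UNIV. L (m - 1) x * pmf (K m x) z)"
      by (rule Lim_transform_eventually)
    from LIMSEQ_unique[OF this L[OF that]] show ?thesis .
  qed
  then show "(\<lambda>m. embed_pmf (L m)) \<in> absolute_probs K"
    by (simp add: absolute_probs_def pmf_L)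
qed

text \<open>
  Compactness: if two rows of the transition matrices into time \<open>n\<close> stayed \<open>\<epsilon>\<close> apart for arbitrarily remote
  starting times, a diagonal subsequence of each of the two families of one-time laws would converge at all
  times simultaneously. The two limits are absolute probabilities, and they differ at time \<open>n\<close>.
\<close>

lemma unique_absolute_probs_imp_weakly_ergodic:
  fixes K :: "int \<Rightarrow> 'e::finite \<Rightarrow> 'e pmf"
  assumes unique: "unique_absolute_probs K" and "n \<le> 0" "\<epsilon> > 0"
  shows "\<exists>m<n. \<forall>x x' z. \<bar>pmf (transition K m n x) z - pmf (transition K m n x') z\<bar> \<le> \<epsilon>"
proof (rule ccontr)
  assume "\<not> ?thesis"
  then have "\<forall>m<n. \<exists>x x' z. \<bar>pmf (transition K m n x) z - pmf (transition K m n x') z\<bar> > \<epsilon>"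
    by (simp add: not_le)
  then have "\<forall>j. \<exists>x x' z. \<bar>pmf (transition K (n - 1 - int j) n x) z
      - pmf (transition K (n - 1 - int j) n x') z\<bar> > \<epsilon>"
    by simp
  then obtain X X' Z where gap: "\<And>j. \<bar>pmf (transition K (n - 1 - int j) n (X j)) (Z j)
      - pmf (transition K (n - 1 - int j) n (X' j)) (Z j)\<bar> > \<epsilon>"
    by metis
  \<comment> \<open>The flag \<open>b\<close> packs both families into one, so that a single subsequence serves both.\<close>
  define f where "f j = (\<lambda>(m, z, b). pmf (transition K (n - 1 - int j) m (if b then X j else X' j)) z)"
    for j :: nat
  have "\<exists>r. strict_mono (r :: nat \<Rightarrow> nat) \<and> (\<forall>t. \<exists>l. (\<lambda>j. f (r j) t) \<longlonglongrightarrow> l)"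
  proof -
    have "norm (f j t) \<le> 1" for j t
      by (auto simp: f_def pmf_le_1 split: prod.split)
    then show ?thesis
      by (rule function_convergent_subsequence[of UNIV f 1, rotated]) auto
  qed
  then obtain r l where r: "strict_mono (r :: nat \<Rightarrow> nat)" and l: "\<And>t. (\<lambda>j. f (r j) t) \<longlonglongrightarrow> l t"
    by metis
  have N: "filterlim (\<lambda>j. n - 1 - int (r j)) at_bot sequentially"
  proof (subst filterlim_at_bot, intro allI)
    fix c
    have "eventually (\<lambda>j. nat (n - 1 - c) \<le> j) sequentially"
      by (rule eventually_ge_at_top)
    then show "eventually (\<lambda>j. n - 1 - int (r j) \<le> c) sequentially"
    proof eventually_elim
      case (elim j)
      with seq_suble[OF r, of j] show ?case by linarith
    qed
  qed
  define L where "L b m z = l (m, z, b)" for b m z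
  have lim: "(\<lambda>j. pmf (transition K (n - 1 - int (r j)) m (X (r j))) z) \<longlonglongrightarrow> L True m z"
    "(\<lambda>j. pmf (transition K (n - 1 - int (r j)) m (X' (r j))) z) \<longlonglongrightarrow> L False m z" for m z
    using l[of "(m, z, True)"] l[of "(m, z, False)"] by (simp_all add: f_def L_def)
  note a = limit_of_transitions_absolute[OF N lim(1)]
    and b = limit_of_transitions_absolute[OF N lim(2)]
  have "embed_pmf (L True n) = embed_pmf (L False n)"
    using unique a(1) b(1) \<open>n \<le> 0\<close> unfolding unique_absolute_probs_def by fastforce
  then have eq: "L True n z = L False n z" for z
    using a(2)[OF \<open>n \<le> 0\<close>, of z] b(2)[OF \<open>n \<le> 0\<close>, of z] by simp
  let ?d = "\<lambda>j z. \<bar>pmf (transition K (n - 1 - int (r j)) n (X (r j))) z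
      - pmf (transition K (n - 1 - int (r j)) n (X' (r j))) z\<bar>"
  have "(\<lambda>j. \<Sum>z\<in>UNIV. ?d j z) \<longlonglongrightarrow> (\<Sum>z\<in>UNIV. \<bar>L True n z - L False n z\<bar>)"
    by (intro tendsto_sum tendsto_rabs tendsto_diff lim)
  then have "(\<lambda>j. \<Sum>z\<in>UNIV. ?d j z) \<longlonglongrightarrow> 0"
    by (simp add: eq)
  then have "eventually (\<lambda>j. (\<Sum>z\<in>UNIV. ?d j z) < \<epsilon>) sequentially"
    using \<open>\<epsilon> > 0\<close> by (rule order_tendstoD)
  then obtain j where "(\<Sum>z\<in>UNIV. ?d j z) < \<epsilon>"
    using eventually_happens by force
  moreover have "?d j (Z (r j)) \<le> (\<Sum>z\<in>UNIV. ?d j z)"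
    by (rule member_le_sum) auto
  ultimately show False
    using gap[of "r j"] by simp
qed

section \<open>Independent random maps and their flow\<close>

abbreviation random_map :: "(int \<Rightarrow> 'e::finite \<Rightarrow> 'e pmf) \<Rightarrow> int \<Rightarrow> ('e \<Rightarrow> 'e) measure" where
  "random_map K n \<equiv> PiM UNIV (\<lambda>x. measure_pmf (K n x))"

lemma sets_random_map [simp]: "sets (random_map K n) = UNIV"
proof -
  have "sets (random_map K n) = sets (PiM UNIV (\<lambda>x::'a. count_space (UNIV :: 'a set)))"
    by (rule sets_PiM_cong) auto
  also have "\<dots> = UNIV"
    by (subst count_space_PiM_finite) (auto intro: countable_finite)
  finally show ?thesis .
qed

lemma space_random_map [simp]: "space (random_map K n) = UNIV"
  by (simp add: space_PiM)

lemma prob_space_random_map: "prob_space (random_map K n)"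
  by (intro prob_space_PiM measure_pmf.prob_space_axioms)

lemma measure_random_map:
  "measure (random_map K n) {f. \<forall>x\<in>J. f x \<in> A x} = (\<Prod>x\<in>J. measure (measure_pmf (K n x)) (A x))"
proof -
  interpret product_prob_space "\<lambda>x. measure_pmf (K n x)" UNIV ..
  have "{f. \<forall>x\<in>J. f x \<in> A x} = emb UNIV J (Pi\<^sub>E J A)"
    by (auto simp: prod_emb_def PiE_iff space_PiM)
  then show ?thesis
    using measure_PiM_emb[of J A] by simp
qed

lemma prob_space_coupling: "prob_space (coupling K)"
  unfolding coupling_def by (intro prob_space_PiM prob_space_random_map)

lemma space_coupling: "space (coupling K) = ({..0} \<rightarrow>\<^sub>E UNIV)"
  by (simp add: coupling_def space_PiM)

lemma measurable_coupling_coord [measurable]: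
  "n \<le> 0 \<Longrightarrow> (\<lambda>\<xi>. \<xi> n) \<in> measurable (coupling K) (count_space UNIV)"
proof -
  assume "n \<le> 0"
  then have "(\<lambda>\<xi>. \<xi> n) \<in> measurable (coupling K) (random_map K n)"
    unfolding coupling_def by (intro measurable_component_singleton) auto
  also have "measurable (coupling K) (random_map K n) = measurable (coupling K) (count_space UNIV)"
    by (intro measurable_cong_sets) auto
  finally show ?thesis .
qed

lemma measure_coupling_box:
  assumes "finite J" "J \<subseteq> {..0}"
  shows "measure (coupling K) {\<xi>\<in>space (coupling K). \<forall>j\<in>J. \<xi> j \<in> A j}
    = (\<Prod>j\<in>J. measure (random_map K j) (A j))"
proof -
  interpret product_prob_space "random_map K" "{..0}"
    by (intro product_prob_space.intro product_sigma_finite.intro product_prob_space_axioms.intro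
        prob_space_imp_sigma_finite prob_space_random_map)
  have "{\<xi>\<in>space (coupling K). \<forall>j\<in>J. \<xi> j \<in> A j} = emb {..0} J (Pi\<^sub>E J A)"
    using assms by (auto simp: space_coupling prod_emb_def PiE_iff space_PiM extensional_def)
  then show ?thesis
    using measure_PiM_emb[of J A] assms by (simp add: coupling_def)
qed

lemma fold_comp_map:
  fixes g :: "'e \<Rightarrow> 'e"
  shows "fold (\<lambda>m f. \<xi> m \<circ> f) ms g = fold (\<lambda>m f. \<xi> m \<circ> f) ms id \<circ> g"
proof (induction ms arbitrary: g)
  case (Cons m ms)
  show ?case
    using Cons.IH[of "\<xi> m \<circ> g"] Cons.IH[of "\<xi> m"] by (simp add: o_assoc)
qed simp

lemma flow_refl [simp]: "flow \<xi> n n = id"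
  by (simp add: flow_def)

text \<open>
  The recursion in the starting time: the flow from \<open>n\<close> applies the map at time \<open>n + 1\<close> and continues with a
  flow that no longer looks at this map.
\<close>

lemma flow_first: "n < k \<Longrightarrow> flow \<xi> n k = flow \<xi> (n + 1) k \<circ> \<xi> (n + 1)"
  by (subst flow_def, subst upto_rec1, simp, subst fold_Cons, unfold o_apply[of "fold _ _"],
      subst fold_comp_map) (simp add: flow_def)

lemma flow_cong: "(\<And>j. j \<in> {n+1..k} \<Longrightarrow> \<xi> j = \<xi>' j) \<Longrightarrow> flow \<xi> n k = flow \<xi>' n k"
  unfolding flow_def by (rule fold_cong) auto

lemma measurable_coupling_flow [measurable]:
  fixes K :: "int \<Rightarrow> 'e::finite \<Rightarrow> 'e pmf"
  assumes "k \<le> 0"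
  shows "(\<lambda>\<xi>. flow \<xi> n k) \<in> measurable (coupling K) (count_space UNIV)"
proof (cases "n \<le> k")
  case True
  then show ?thesis
  proof (induction n rule: int_le_induct)
    case (step n)
    have [measurable]: "(\<lambda>\<xi>. flow \<xi> n k) \<in> measurable (coupling K) (count_space UNIV)"
      "(\<lambda>\<xi>. \<xi> n) \<in> measurable (coupling K) (count_space UNIV)"
      using step assms by auto
    have "(\<lambda>\<xi>. f \<circ> \<xi> n) \<in> measurable (coupling K) (count_space UNIV)" for f :: "'e \<Rightarrow> 'e"
      by (rule measurable_compose[of "\<lambda>\<xi>. \<xi> n" _ "count_space UNIV"]) auto
    then have "(\<lambda>\<xi>. flow \<xi> n k \<circ> \<xi> n) \<in> measurable (coupling K) (count_space UNIV)"
      by (rule measurable_compose_countable'[where f="\<lambda>f \<xi>. f \<circ> \<xi> n" and g="\<lambda>\<xi>. flow \<xi> n k" and I=UNIV])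
        (simp_all add: countable_finite)
    moreover have "(\<lambda>\<xi> :: int \<Rightarrow> 'e \<Rightarrow> 'e. flow \<xi> (n - 1) k) = (\<lambda>\<xi>. flow \<xi> n k \<circ> \<xi> n)"
      using step by (intro ext) (simp add: flow_first)
    ultimately show ?case
      by (simp only:)
  qed (simp add: id_def)
qed (simp add: flow_def)

text \<open>
  The flow from \<open>n\<close> to \<open>k\<close> is a function of the finitely many maps at times \<open>n + 1, \<dots>, k\<close>. Splitting an event
  according to the values of these maps reduces independence of the map at time \<open>n\<close> to the product formula
  for boxes.
\<close>

lemma flow_independent_of_previous_map:
  fixes K :: "int \<Rightarrow> 'e::finite \<Rightarrow> 'e pmf"
  assumes "n \<le> k" "k \<le> 0"
  shows "measure (coupling K) {\<xi>\<in>space (coupling K). \<xi> n \<in> S \<and> flow \<xi> n k \<in> T}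
    = measure (random_map K n) S * measure (coupling K) {\<xi>\<in>space (coupling K). flow \<xi> n k \<in> T}"
proof -
  interpret prob_space "coupling K" by (rule prob_space_coupling)
  \<comment> \<open>The values of the maps that lead to an admissible flow.\<close>
  define W where "W = {w \<in> {n+1..k} \<rightarrow>\<^sub>E (UNIV :: ('e \<Rightarrow> 'e) set). flow w n k \<in> T}"
  have fin: "finite W"
    by (auto simp: W_def intro!: finite_subset[OF _ finite_PiE[of "{n+1..k}" "\<lambda>_. UNIV :: ('e \<Rightarrow> 'e) set"]])
  have decomp: "{\<xi>\<in>space (coupling K). \<xi> n \<in> S' \<and> flow \<xi> n k \<in> T}
    = (\<Union>w\<in>W. {\<xi>\<in>space (coupling K). \<forall>j\<in>{n..k}. \<xi> j \<in> (if j = n then S' else {w j})})" for S'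
  proof (intro set_eqI iffI)
    fix \<xi> assume \<xi>: "\<xi> \<in> {\<xi>\<in>space (coupling K). \<xi> n \<in> S' \<and> flow \<xi> n k \<in> T}"
    have "flow (restrict \<xi> {n+1..k}) n k = flow \<xi> n k"
      by (rule flow_cong) simp
    with \<xi> have "restrict \<xi> {n+1..k} \<in> W"
      by (simp add: W_def)
    with \<xi> show "\<xi> \<in> (\<Union>w\<in>W. {\<xi>\<in>space (coupling K). \<forall>j\<in>{n..k}. \<xi> j \<in> (if j = n then S' else {w j})})"
      by (intro UN_I[of "restrict \<xi> {n+1..k}"]) auto
  next
    fix \<xi> assume "\<xi> \<in> (\<Union>w\<in>W. {\<xi>\<in>space (coupling K). \<forall>j\<in>{n..k}. \<xi> j \<in> (if j = n then S' else {w j})})"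
    then obtain w where w: "w \<in> W" "\<xi> \<in> space (coupling K)"
      "\<forall>j\<in>{n..k}. \<xi> j \<in> (if j = n then S' else {w j})" by auto
    then have "flow \<xi> n k = flow w n k"
      by (intro flow_cong) (force split: if_splits)
    moreover have "\<xi> n \<in> S'"
      using w(3) \<open>n \<le> k\<close> by force
    ultimately show "\<xi> \<in> {\<xi>\<in>space (coupling K). \<xi> n \<in> S' \<and> flow \<xi> n k \<in> T}"
      using w by (auto simp: W_def)
  qed
  have disj: "disjoint_family_on
    (\<lambda>w. {\<xi>\<in>space (coupling K). \<forall>j\<in>{n..k}. \<xi> j \<in> (if j = n then S' else {w j})}) W" for S'
  proof (unfold disjoint_family_on_def, intro ballI impI, rule ccontr)
    fix w w' assume w: "w \<in> W" "w' \<in> W" "w \<noteq> w'"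
      and "{\<xi>\<in>space (coupling K). \<forall>j\<in>{n..k}. \<xi> j \<in> (if j = n then S' else {w j})}
        \<inter> {\<xi>\<in>space (coupling K). \<forall>j\<in>{n..k}. \<xi> j \<in> (if j = n then S' else {w' j})} \<noteq> {}"
    then obtain \<xi> where \<xi>: "\<forall>j\<in>{n..k}. \<xi> j \<in> (if j = n then S' else {w j})"
      "\<forall>j\<in>{n..k}. \<xi> j \<in> (if j = n then S' else {w' j})"
      by auto
    have "w j = w' j" for j
    proof (cases "j \<in> {n+1..k}")
      case True
      then have "j \<in> {n..k}" "j \<noteq> n" by auto
      with \<xi> show ?thesis by (metis singletonD)
    next
      case False
      with w show ?thesis by (auto simp: W_def PiE_iff extensional_def)
    qed
    with w show False by auto
  qed
  have sum: "measure (coupling K) {\<xi>\<in>space (coupling K). \<xi> n \<in> S' \<and> flow \<xi> n k \<in> T}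
      = measure (random_map K n) S' * (\<Sum>w\<in>W. \<Prod>j\<in>{n+1..k}. measure (random_map K j) {w j})" for S'
  proof -
    have split: "{n..k} = insert n {n+1..k}"
      using \<open>n \<le> k\<close> by auto
    have "measure (coupling K) {\<xi>\<in>space (coupling K). \<xi> n \<in> S' \<and> flow \<xi> n k \<in> T}
      = (\<Sum>w\<in>W. measure (coupling K) {\<xi>\<in>space (coupling K). \<forall>j\<in>{n..k}. \<xi> j \<in> (if j = n then S' else {w j})})"
      unfolding decomp
      using assms by (intro finite_measure_finite_Union[OF fin _ disj]) auto
    also have "\<dots> = (\<Sum>w\<in>W. measure (random_map K n) S' * (\<Prod>j\<in>{n+1..k}. measure (random_map K j) {w j}))"
    proof (rule sum.cong[OF refl])
      fix w
      have "measure (coupling K) {\<xi>\<in>space (coupling K). \<forall>j\<in>{n..k}. \<xi> j \<in> (if j = n then S' else {w j})}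
        = (\<Prod>j\<in>{n..k}. measure (random_map K j) (if j = n then S' else {w j}))"
        using assms by (intro measure_coupling_box) auto
      also have "\<dots> = measure (random_map K n) S' * (\<Prod>j\<in>{n+1..k}. measure (random_map K j) (if j = n then S' else {w j}))"
        unfolding split by (subst prod.insert) auto
      also have "(\<Prod>j\<in>{n+1..k}. measure (random_map K j) (if j = n then S' else {w j}))
          = (\<Prod>j\<in>{n+1..k}. measure (random_map K j) {w j})"
        by (rule prod.cong) auto
      finally show "measure (coupling K) {\<xi>\<in>space (coupling K). \<forall>j\<in>{n..k}. \<xi> j \<in> (if j = n then S' else {w j})}
        = measure (random_map K n) S' * (\<Prod>j\<in>{n+1..k}. measure (random_map K j) {w j})" .
    qed
    finally show ?thesis
      by (simp add: sum_distrib_left)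
  qed
  have "measure (random_map K n) UNIV = 1"
    using prob_space.prob_space[OF prob_space_random_map, of K n] by simp
  then show ?thesis
    using sum[of S] sum[of UNIV] by simp
qed

section \<open>Merging of two trajectories\<close>

lemma measure_random_map_single: "measure (random_map K n) {f. f x = e} = pmf (K n x) e"
  using measure_random_map[of K n "{x}" "\<lambda>_. {e}"] by (simp add: measure_pmf_single)

lemma measure_random_map_pair:
  "x \<noteq> x' \<Longrightarrow> measure (random_map K n) {f. f x = e \<and> f x' = e'} = pmf (K n x) e * pmf (K n x') e'"
  using measure_random_map[of K n "{x, x'}" "\<lambda>y. {if y = x then e else e'}"]
  by (simp add: measure_pmf_single)

text \<open>
  By independence of the first map from the rest of the flow, the law of a single trajectory satisfies the
  first-step recursion of the transition probabilities.
\<close>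

lemma measure_coupling_flow:
  assumes "n \<le> k" "k \<le> 0"
  shows "measure (coupling K) {\<xi>\<in>space (coupling K). flow \<xi> n k x = z} = pmf (transition K n k x) z"
  using assms(1)
proof (induction n arbitrary: x rule: int_le_induct)
  case base
  interpret prob_space "coupling K" by (rule prob_space_coupling)
  show ?case by (cases "x = z") (simp_all add: prob_space)
next
  case (step n)
  interpret prob_space "coupling K" by (rule prob_space_coupling)
  have [measurable]: "(\<lambda>\<xi>. flow \<xi> n k) \<in> measurable (coupling K) (count_space UNIV)"
    "(\<lambda>\<xi>. \<xi> n) \<in> measurable (coupling K) (count_space UNIV)"
    using step assms by auto
  have events: "{\<xi>\<in>space (coupling K). \<xi> n \<in> S \<and> flow \<xi> n k \<in> T} \<in> events" for S T
    by measurable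
  have "{\<xi>\<in>space (coupling K). flow \<xi> (n - 1) k x = z} = (\<Union>e\<in>UNIV. {\<xi>\<in>space (coupling K). \<xi> n \<in> {f. f x = e} \<and> flow \<xi> n k \<in> {h. h e = z}})"
    using step by (auto simp: flow_first)
  then have "measure (coupling K) {\<xi>\<in>space (coupling K). flow \<xi> (n - 1) k x = z}
    = measure (coupling K) (\<Union>e\<in>UNIV. {\<xi>\<in>space (coupling K). \<xi> n \<in> {f. f x = e} \<and> flow \<xi> n k \<in> {h. h e = z}})"
    by (rule arg_cong)
  also have "\<dots>
    = (\<Sum>e\<in>UNIV. measure (coupling K) {\<xi>\<in>space (coupling K). \<xi> n \<in> {f. f x = e} \<and> flow \<xi> n k \<in> {h. h e = z}})"
  proof (rule finite_measure_finite_Union)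
    show "(\<lambda>e. {\<xi>\<in>space (coupling K). \<xi> n \<in> {f. f x = e} \<and> flow \<xi> n k \<in> {h. h e = z}}) ` UNIV \<subseteq> events"
      by (rule image_subsetI, rule events)
  qed (auto simp: disjoint_family_on_def)
  also have "\<dots> = (\<Sum>e\<in>UNIV. pmf (K n x) e * pmf (transition K n k e) z)"
    using step assms
    by (intro sum.cong[OF refl], subst flow_independent_of_previous_map)
      (simp_all add: measure_random_map_single)
  also have "\<dots> = pmf (transition K (n - 1) k x) z"
    using step by (simp add: transition_first[of "n - 1"] pmf_bind_finite)
  finally show ?case .
qed

text \<open>
  The target time \<open>k\<close> comes before the starting time \<open>n\<close>: in all estimates \<open>k\<close> is fixed and \<open>n\<close> varies.
\<close>

definition unmerged :: "(int \<Rightarrow> 'e::finite \<Rightarrow> 'e pmf) \<Rightarrow> int \<Rightarrow> int \<Rightarrow> 'e \<Rightarrow> 'e \<Rightarrow> real" where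
  "unmerged K k n x x' = measure (coupling K) {\<xi>\<in>space (coupling K). flow \<xi> n k x \<noteq> flow \<xi> n k x'}"

lemma unmerged_diag [simp]: "unmerged K k n x x = 0"
  by (simp add: unmerged_def)

lemma unmerged_nonneg: "0 \<le> unmerged K k n x x'"
  by (simp add: unmerged_def)

lemma unmerged_le_1: "unmerged K k n x x' \<le> 1"
  unfolding unmerged_def by (rule prob_space.prob_le_1[OF prob_space_coupling])

lemma sum_UNIV_prod: "(\<Sum>p\<in>UNIV. h p) = (\<Sum>a\<in>UNIV. \<Sum>b\<in>UNIV. h (a, b))"
  by (simp add: sum.cartesian_product)

text \<open>
  Two trajectories that start in different states take independent first steps; two that start in the same
  state never separate, which makes the left-hand side vanish.
\<close>

lemma unmerged_step:
  assumes "n \<le> k" "k \<le> 0"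
  shows "unmerged K k (n - 1) x x'
    \<le> (\<Sum>e\<in>UNIV. pmf (K n x) e * (\<Sum>e'\<in>UNIV. pmf (K n x') e' * unmerged K k n e e'))"
proof (cases "x = x'")
  case True
  then show ?thesis
    by (auto intro!: sum_nonneg mult_nonneg_nonneg unmerged_nonneg)
next
  case False
  interpret prob_space "coupling K" by (rule prob_space_coupling)
  have [measurable]: "(\<lambda>\<xi>. flow \<xi> n k) \<in> measurable (coupling K) (count_space UNIV)"
    "(\<lambda>\<xi>. \<xi> n) \<in> measurable (coupling K) (count_space UNIV)"
    using assms by auto
  have events: "{\<xi>\<in>space (coupling K). \<xi> n \<in> S \<and> flow \<xi> n k \<in> T} \<in> events" for S T
    by measurable
  let ?A = "\<lambda>(e, e'). {\<xi>\<in>space (coupling K). \<xi> n \<in> {f. f x = e \<and> f x' = e'} \<and> flow \<xi> n k \<in> {h. h e \<noteq> h e'}}"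
  have "{\<xi>\<in>space (coupling K). flow \<xi> (n - 1) k x \<noteq> flow \<xi> (n - 1) k x'} = (\<Union>p\<in>UNIV. ?A p)"
    using assms by (auto simp: flow_first)
  then have "unmerged K k (n - 1) x x' = measure (coupling K) (\<Union>p\<in>UNIV. ?A p)"
    by (simp add: unmerged_def)
  also have "\<dots> = (\<Sum>p\<in>UNIV. measure (coupling K) (?A p))"
  proof (rule finite_measure_finite_Union)
    show "range ?A \<subseteq> events"
      unfolding split_def by (rule image_subsetI, rule events)
  qed (auto simp: disjoint_family_on_def)
  also have "\<dots> = (\<Sum>e\<in>UNIV. \<Sum>e'\<in>UNIV. measure (coupling K) (?A (e, e')))"
    by (rule sum_UNIV_prod)
  also have "\<dots> = (\<Sum>e\<in>UNIV. pmf (K n x) e * (\<Sum>e'\<in>UNIV. pmf (K n x') e' * unmerged K k n e e'))"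
    unfolding prod.case using assms False
    by (subst flow_independent_of_previous_map)
      (simp_all add: measure_random_map_pair unmerged_def sum_distrib_left mult.assoc)
  finally show ?thesis by simp
qed

lemma sum_pmf_bind:
  fixes r :: "'e::finite pmf"
  shows "(\<Sum>e\<in>UNIV. pmf (bind_pmf r f) e * v e) = (\<Sum>a\<in>UNIV. pmf r a * (\<Sum>e\<in>UNIV. pmf (f a) (e :: 'e) * v e :: real))"
  unfolding pmf_bind_finite sum_distrib_left sum_distrib_right
  by (subst sum.swap) (simp add: mult.assoc)

lemma sum_swap_weights:
  fixes u :: "'a \<Rightarrow> real"
  shows "(\<Sum>a\<in>A. u a * (\<Sum>b\<in>B. v b * F a b)) = (\<Sum>b\<in>B. v b * (\<Sum>a\<in>A. u a * F a b))"
  unfolding sum_distrib_left by (subst sum.swap) (simp add: mult_ac)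

text \<open>
  Before they meet, the two trajectories move like two independent chains. Letting the independent chains
  continue independently after a meeting only enlarges the bound.
\<close>

lemma unmerged_transition:
  assumes "m \<le> n" "n \<le> k" "k \<le> 0"
  shows "unmerged K k m x x' \<le> (\<Sum>e\<in>UNIV. pmf (transition K m n x) e *
    (\<Sum>e'\<in>UNIV. pmf (transition K m n x') e' * unmerged K k n e e'))"
  using assms(1)
proof (induction m arbitrary: x x' rule: int_le_induct)
  case base
  show ?case
    by (simp add: pmf_return indicator_def if_distrib[of "\<lambda>t. t * _"] cong: if_cong)
next
  case (step m)
  let ?u = "unmerged K k n" and ?T = "transition K m n"
  have "unmerged K k (m - 1) x x'
    \<le> (\<Sum>a\<in>UNIV. pmf (K m x) a * (\<Sum>a'\<in>UNIV. pmf (K m x') a' * unmerged K k m a a'))"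
    using step assms by (intro unmerged_step) auto
  also have "\<dots> \<le> (\<Sum>a\<in>UNIV. pmf (K m x) a * (\<Sum>a'\<in>UNIV. pmf (K m x') a' *
      (\<Sum>e\<in>UNIV. pmf (?T a) e * (\<Sum>e'\<in>UNIV. pmf (?T a') e' * ?u e e'))))"
    by (intro sum_mono mult_left_mono step.IH) auto
  also have "\<dots> = (\<Sum>a\<in>UNIV. pmf (K m x) a * (\<Sum>e\<in>UNIV. pmf (?T a) e *
      (\<Sum>a'\<in>UNIV. pmf (K m x') a' * (\<Sum>e'\<in>UNIV. pmf (?T a') e' * ?u e e'))))"
    by (rule sum.cong[OF refl], subst sum_swap_weights, rule refl)
  also have "\<dots> = (\<Sum>e\<in>UNIV. pmf (bind_pmf (K m x) ?T) e *
      (\<Sum>e'\<in>UNIV. pmf (bind_pmf (K m x') ?T) e' * ?u e e'))"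
    by (simp only: sum_pmf_bind)
  finally show ?case
    using step by (simp add: transition_first[of "m - 1"])
qed

text \<open>
  Two independent draws from one distribution on \<open>s\<close> points agree with probability at least \<open>1 / s\<close>,
  the value for the uniform distribution.
\<close>

lemma sum_pmf_square_ge:
  fixes r :: "'e::finite pmf"
  shows "1 / real CARD('e) \<le> (\<Sum>e\<in>UNIV. (pmf r e)\<^sup>2)"
proof -
  let ?s = "real CARD('e)"
  have "0 \<le> (\<Sum>e\<in>UNIV. (pmf r e - 1 / ?s)\<^sup>2)"
    by (intro sum_nonneg) auto
  also have "\<dots> = (\<Sum>e\<in>UNIV. (pmf r e)\<^sup>2) - 2 / ?s * (\<Sum>e\<in>UNIV. pmf r e) + ?s * (1 / ?s)\<^sup>2"
  proof -
    have "(pmf r e - 1 / ?s)\<^sup>2 = (pmf r e)\<^sup>2 - 2 / ?s * pmf r e + (1 / ?s)\<^sup>2" for e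
      by (simp add: power2_diff)
    then show ?thesis
      by (simp add: sum.distrib sum_subtractf sum_distrib_left)
  qed
  also have "\<dots> = (\<Sum>e\<in>UNIV. (pmf r e)\<^sup>2) - 1 / ?s"
    by (simp add: sum_pmf_UNIV power2_eq_square field_simps)
  finally show ?thesis by simp
qed

text \<open>
  If the rows of the transition matrix from \<open>m\<close> to \<open>n\<close> agree up to \<open>1 / (2 s)\<close>, two independent chains that
  start at time \<open>m\<close> behave at time \<open>n\<close> almost like two draws from one distribution, and therefore meet there
  with probability at least \<open>1 / s - 1 / (2 s) = 1 / (2 s)\<close>.
\<close>

lemma unmerged_contraction:
  fixes K :: "int \<Rightarrow> 'e::finite \<Rightarrow> 'e pmf"
  assumes "m \<le> n" "n \<le> k" "k \<le> 0"
    and close: "\<And>x x' z. \<bar>pmf (transition K m n x) z - pmf (transition K m n x') z\<bar> \<le> 1 / (2 * real CARD('e))"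
    and d: "\<And>e e'. unmerged K k n e e' \<le> d"
  shows "unmerged K k m x x' \<le> (1 - 1 / (2 * real CARD('e))) * d"
proof -
  let ?p = "pmf (transition K m n x)" and ?p' = "pmf (transition K m n x')"
  have "0 \<le> d"
    using d unmerged_nonneg order_trans by blast
  \<comment> \<open>The probability that the two independent chains meet at time \<open>n\<close>.\<close>
  have meet: "1 / (2 * real CARD('e)) \<le> (\<Sum>e\<in>UNIV. ?p e * ?p' e)"
  proof -
    define c where "c = 1 / (2 * real CARD('e))"
    have "1 / real CARD('e) - c \<le> (\<Sum>e\<in>UNIV. (?p e)\<^sup>2) - c * (\<Sum>e\<in>UNIV. ?p e)"
      using sum_pmf_square_ge by (simp add: sum_pmf_UNIV)
    also have "\<dots> = (\<Sum>e\<in>UNIV. ?p e * (?p e - c))"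
      by (simp add: sum_subtractf sum_distrib_left right_diff_distrib power2_eq_square mult.commute)
    also have "\<dots> \<le> (\<Sum>e\<in>UNIV. ?p e * ?p' e)"
    proof (intro sum_mono mult_left_mono)
      fix e show "?p e - c \<le> ?p' e"
        using close[of x e x'] by (simp add: c_def)
    qed auto
    finally show ?thesis
      by (simp add: c_def field_simps)
  qed
  have "unmerged K k m x x' \<le> (\<Sum>e\<in>UNIV. ?p e * (\<Sum>e'\<in>UNIV. ?p' e' * unmerged K k n e e'))"
    by (rule unmerged_transition) fact+
  \<comment> \<open>Merged pairs stay merged, all others contribute at most \<open>d\<close>.\<close>
  also have "\<dots> \<le> (\<Sum>e\<in>UNIV. ?p e * (\<Sum>e'\<in>UNIV. ?p' e' * (d - (if e' = e then d else 0))))"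
    using d by (intro sum_mono mult_left_mono) auto
  also have "\<dots> = (\<Sum>e\<in>UNIV. ?p e * (d - ?p' e * d))"
    by (simp add: right_diff_distrib sum_subtractf sum_distrib_right[symmetric] sum_pmf_UNIV
        if_distrib[of "\<lambda>t. _ * t"] cong: if_cong)
  also have "\<dots> = (1 - (\<Sum>e\<in>UNIV. ?p e * ?p' e)) * d"
    by (simp add: right_diff_distrib left_diff_distrib sum_subtractf sum_distrib_right[symmetric] sum_pmf_UNIV mult.assoc[symmetric])
  also have "\<dots> \<le> (1 - 1 / (2 * real CARD('e))) * d"
    using meet \<open>0 \<le> d\<close> by (intro mult_right_mono) auto
  finally show ?thesis .
qed

text \<open>
  Weak ergodicity can be applied again and again, each time further in the past, so that the contraction
  factor \<open>1 - 1 / (2 s)\<close> is collected arbitrarily often.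
\<close>

lemma unmerged_tendsto_0:
  fixes K :: "int \<Rightarrow> 'e::finite \<Rightarrow> 'e pmf"
  assumes unique: "unique_absolute_probs K" and "k \<le> 0" "\<epsilon> > 0"
  shows "\<exists>n<k. \<forall>x x'. unmerged K k n x x' \<le> \<epsilon>"
proof -
  define c where "c = 1 - 1 / (2 * real CARD('e))"
  have "0 < CARD('e)"
    by (rule zero_less_card_finite)
  then have "1 \<le> 2 * real CARD('e)"
    by linarith
  then have "1 / (2 * real CARD('e)) \<le> 1"
    by (subst divide_le_eq_1_pos) linarith+
  then have c: "0 \<le> c" "c < 1"
    by (auto simp: c_def)
  \<comment> \<open>The starting time lies at least \<open>j\<close> steps before \<open>k\<close>; taking one factor more than necessary makes it
    strictly smaller than \<open>k\<close>.\<close>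
  have bound: "\<exists>n\<le>k - int j. \<forall>x x'. unmerged K k n x x' \<le> c ^ j" for j
  proof (induction j)
    case 0
    show ?case by (auto intro: exI[of _ k] unmerged_le_1)
  next
    case (Suc j)
    then obtain n where n: "n \<le> k - int j" "\<And>x x'. unmerged K k n x x' \<le> c ^ j"
      by auto
    then obtain m where m: "m < n" "\<And>x x' z. \<bar>pmf (transition K m n x) z - pmf (transition K m n x') z\<bar>
        \<le> 1 / (2 * real CARD('e))"
      using unique_absolute_probs_imp_weakly_ergodic[OF unique, of n "1 / (2 * real CARD('e))"] \<open>k \<le> 0\<close> by auto
    have "unmerged K k m x x' \<le> c * c ^ j" for x x'
      unfolding c_def[of] using n m assms by (intro unmerged_contraction[where n=n]) (auto simp: c_def)
    with m(1) n(1) show ?case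
      by (intro exI[of _ m]) auto
  qed
  obtain j where "c ^ j < \<epsilon>"
    using real_arch_pow_inv[OF \<open>\<epsilon> > 0\<close> c(2)] by auto
  moreover have "c ^ Suc j \<le> c ^ j"
    using c by (intro power_decreasing) auto
  moreover obtain n where "n \<le> k - int (Suc j)" "\<forall>x x'. unmerged K k n x x' \<le> c ^ Suc j"
    using bound by blast
  ultimately show ?thesis
    by (intro exI[of _ n] conjI allI) (linarith, meson less_imp_le order_trans)
qed

section \<open>Coalescence and uniqueness of absolute probabilities\<close>

text \<open>
  The condition in \<^const>\<open>coalescence_time\<close>, named because it is used as an event.
\<close>

definition coalesced :: "int \<Rightarrow> int \<Rightarrow> (int \<Rightarrow> 'e \<Rightarrow> 'e) \<Rightarrow> bool" where
  "coalesced n k \<xi> \<longleftrightarrow> is_singleton (range (flow \<xi> n k))"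

lemma coalesced_iff: "coalesced n k \<xi> \<longleftrightarrow> (\<forall>x x'. flow \<xi> n k x = flow \<xi> n k x')"
proof
  assume "coalesced n k \<xi>"
  then obtain c where "range (flow \<xi> n k) = {c}"
    by (auto simp: coalesced_def is_singleton_def)
  then have "flow \<xi> n k x = c" for x
    by (metis rangeI singletonD)
  then show "\<forall>x x'. flow \<xi> n k x = flow \<xi> n k x'" by simp
next
  assume "\<forall>x x'. flow \<xi> n k x = flow \<xi> n k x'"
  then show "coalesced n k \<xi>"
    unfolding coalesced_def by (intro is_singletonI') auto
qed

lemma coalescence_time_finite_iff:
  "coalescence_time k \<xi> > - \<infinity> \<longleftrightarrow> (\<exists>n<k. coalesced n k \<xi>)"
  by (auto simp: coalescence_time_def less_Sup_iff coalesced_def)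

definition coalescing :: "(int \<Rightarrow> 'e::finite \<Rightarrow> 'e pmf) \<Rightarrow> bool" where
  "coalescing K \<longleftrightarrow> measure (coupling K)
     {\<xi> \<in> space (coupling K). \<forall>n\<le>0. coalescence_time n \<xi> > -\<infinity>} = 1"

lemma sets_coupling_flow:
  assumes "k \<le> 0"
  shows "{\<xi>\<in>space (coupling K). R (flow \<xi> n k)} \<in> sets (coupling K)"
  using measurable_sets[OF measurable_coupling_flow[OF assms, of n K], of "Collect R"]
  by (simp add: vimage_def Int_def conj_commute)

lemma measurable_coalesced [measurable]:
  "k \<le> 0 \<Longrightarrow> Measurable.pred (coupling K) (coalesced n k)"
  using sets_coupling_flow[of k K "\<lambda>h. \<forall>x x'. h x = h x'" n]
  by (simp add: pred_def coalesced_iff)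

text \<open>
  Images of the flow shrink when the starting time decreases, so coalescence from some starting time has
  probability one exactly if the probability of coalescence from a fixed starting time can be made
  arbitrarily close to one. Only countably many target times occur.
\<close>

lemma coalescing_iff:
  "coalescing K \<longleftrightarrow> (\<forall>k\<le>0. \<forall>\<epsilon>>0. \<exists>n<k.
     measure (coupling K) {\<xi> \<in> space (coupling K). \<not> coalesced n k \<xi>} \<le> \<epsilon>)"
proof -
  interpret prob_space "coupling K" by (rule prob_space_coupling)
  have [measurable]: "k \<le> 0 \<Longrightarrow> Measurable.pred (coupling K) (\<lambda>\<xi>. \<exists>n<k. coalesced n k \<xi>)" for k
    by measurable
  have "coalescing K \<longleftrightarrow> (AE \<xi> in coupling K. \<forall>k\<le>0. \<exists>n<k. coalesced n k \<xi>)"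
    unfolding coalescing_def coalescence_time_finite_iff by (rule prob_Collect_eq_1) measurable
  also have "\<dots> \<longleftrightarrow> (\<forall>k\<le>0. AE \<xi> in coupling K. \<exists>n<k. coalesced n k \<xi>)"
    by (simp add: AE_all_countable)
  also have "\<dots> \<longleftrightarrow> (\<forall>k\<le>0. \<forall>\<epsilon>>0. \<exists>n<k. prob {\<xi> \<in> space (coupling K). \<not> coalesced n k \<xi>} \<le> \<epsilon>)"
  proof (intro all_cong iffI allI impI)
    fix k :: int and \<epsilon> :: real assume "k \<le> 0" "AE \<xi> in coupling K. \<exists>n<k. coalesced n k \<xi>" "\<epsilon> > 0"
    note [measurable] = measurable_coalesced[OF \<open>k \<le> 0\<close>]
    let ?A = "\<lambda>j. {\<xi> \<in> space (coupling K). \<not> coalesced (k - 1 - int j) k \<xi>}"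
    have "flow \<xi> (k - 1 - int (Suc j)) k = flow \<xi> (k - 1 - int j) k \<circ> \<xi> (k - 1 - int j)"
      for \<xi> :: "int \<Rightarrow> 'a \<Rightarrow> 'a" and j
      using flow_first[of "k - 1 - int (Suc j)" k \<xi>] by (simp add: algebra_simps)
    then have dec: "?A (Suc j) \<subseteq> ?A j" for j
      unfolding coalesced_iff by auto
    have "(\<Inter>j. ?A j) = {\<xi> \<in> space (coupling K). \<not> (\<exists>n<k. coalesced n k \<xi>)}"
    proof (intro set_eqI iffI)
      fix \<xi> assume \<xi>: "\<xi> \<in> (\<Inter>j. ?A j)"
      { fix n assume "n < k"
        then have "n = k - 1 - int (nat (k - 1 - n))" by simp
        with \<xi> have "\<not> coalesced n k \<xi>"
          by (metis (no_types, lifting) INT_iff UNIV_I mem_Collect_eq) }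
      with \<xi> show "\<xi> \<in> {\<xi> \<in> space (coupling K). \<not> (\<exists>n<k. coalesced n k \<xi>)}"
        by auto
    qed auto
    moreover have "prob {\<xi> \<in> space (coupling K). \<not> (\<exists>n<k. coalesced n k \<xi>)} = 0"
      using \<open>AE \<xi> in coupling K. \<exists>n<k. coalesced n k \<xi>\<close>
      by (subst prob_Collect_eq_0) auto
    moreover have "(\<lambda>j. prob (?A j)) \<longlonglongrightarrow> prob (\<Inter>j. ?A j)"
      by (rule finite_Lim_measure_decseq) (auto intro!: decseq_SucI dec)
    ultimately have "(\<lambda>j. prob (?A j)) \<longlonglongrightarrow> 0"
      by simp
    then have "eventually (\<lambda>j. prob (?A j) < \<epsilon>) sequentially"
      using \<open>\<epsilon> > 0\<close> by (rule order_tendstoD)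
    then obtain j where "prob (?A j) < \<epsilon>"
      using eventually_happens by force
    then show "\<exists>n<k. prob {\<xi> \<in> space (coupling K). \<not> coalesced n k \<xi>} \<le> \<epsilon>"
      by (intro exI[of _ "k - 1 - int j"]) auto
  next
    fix k :: int assume "k \<le> 0"
      and *: "\<forall>\<epsilon>>0. \<exists>n<k. prob {\<xi> \<in> space (coupling K). \<not> coalesced n k \<xi>} \<le> \<epsilon>"
    note [measurable] = measurable_coalesced[OF \<open>k \<le> 0\<close>]
    have "prob {\<xi> \<in> space (coupling K). \<not> (\<exists>n<k. coalesced n k \<xi>)} \<le> 0"
    proof (rule field_le_epsilon)
      fix \<epsilon> :: real assume "\<epsilon> > 0"
      with * obtain n where "n < k" "prob {\<xi> \<in> space (coupling K). \<not> coalesced n k \<xi>} \<le> \<epsilon>"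
        by auto
      moreover from this have "prob {\<xi> \<in> space (coupling K). \<not> (\<exists>n<k. coalesced n k \<xi>)}
          \<le> prob {\<xi> \<in> space (coupling K). \<not> coalesced n k \<xi>}"
        by (intro finite_measure_mono) auto
      ultimately show "prob {\<xi> \<in> space (coupling K). \<not> (\<exists>n<k. coalesced n k \<xi>)} \<le> 0 + \<epsilon>"
        by simp
    qed
    then have "prob {\<xi> \<in> space (coupling K). \<not> (\<exists>n<k. coalesced n k \<xi>)} = 0"
      by (simp add: measure_le_0_iff)
    then show "AE \<xi> in coupling K. \<exists>n<k. coalesced n k \<xi>"
      using \<open>k \<le> 0\<close> by (subst (asm) prob_Collect_eq_0) auto
  qed
  finally show ?thesis .
qed

text \<open>
  The flow fails to coalesce only if one of the \<open>s\<^sup>2\<close> pairs of states remains unmerged.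
\<close>

lemma unique_absolute_probs_imp_coalescing:
  fixes K :: "int \<Rightarrow> 'e::finite \<Rightarrow> 'e pmf"
  assumes unique: "unique_absolute_probs K"
  shows "coalescing K"
  unfolding coalescing_iff
proof (intro allI impI)
  fix k :: int and \<epsilon> :: real assume "k \<le> 0" "\<epsilon> > 0"
  interpret prob_space "coupling K" by (rule prob_space_coupling)
  note [measurable] = measurable_coupling_flow[OF \<open>k \<le> 0\<close>]
  let ?s = "real CARD('e)"
  obtain n where n: "n < k" "\<And>x x'. unmerged K k n x x' \<le> \<epsilon> / ?s\<^sup>2"
    using unmerged_tendsto_0[OF unique \<open>k \<le> 0\<close>, of "\<epsilon> / ?s\<^sup>2"] \<open>\<epsilon> > 0\<close> by auto
  have "{\<xi> \<in> space (coupling K). \<not> coalesced n k \<xi>}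
      = (\<Union>(x, x')\<in>UNIV. {\<xi>\<in>space (coupling K). flow \<xi> n k x \<noteq> flow \<xi> n k x'})"
    by (auto simp: coalesced_iff)
  then have "prob {\<xi> \<in> space (coupling K). \<not> coalesced n k \<xi>}
      = prob (\<Union>(x, x')\<in>UNIV. {\<xi>\<in>space (coupling K). flow \<xi> n k x \<noteq> flow \<xi> n k x'})"
    by (rule arg_cong)
  also have "\<dots> \<le> (\<Sum>(x, x')\<in>UNIV. unmerged K k n x x')"
    unfolding unmerged_def split_def
    using sets_coupling_flow[OF \<open>k \<le> 0\<close>, of K "\<lambda>h. h a \<noteq> h b" n for a b]
    by (intro finite_measure_subadditive_finite) auto
  also have "\<dots> \<le> (\<Sum>(x, x')\<in>(UNIV :: ('e \<times> 'e) set). \<epsilon> / ?s\<^sup>2)"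
    using n(2) by (intro sum_mono) auto
  also have "\<dots> = \<epsilon>"
    by (simp add: split_def card_prod power2_eq_square UNIV_Times_UNIV[symmetric] card_cartesian_product del: UNIV_Times_UNIV)
  finally show "\<exists>n<k. prob {\<xi> \<in> space (coupling K). \<not> coalesced n k \<xi>} \<le> \<epsilon>"
    using n(1) by blast
qed

text \<open>
  The coupling inequality: trajectories from \<open>x\<close> and \<open>x'\<close> end in the same state once the flow has coalesced.
\<close>

lemma transition_close_of_coalesced:
  assumes "n \<le> k" "k \<le> 0"
  shows "\<bar>pmf (transition K n k x) z - pmf (transition K n k x') z\<bar>
    \<le> measure (coupling K) {\<xi> \<in> space (coupling K). \<not> coalesced n k \<xi>}"
proof -
  interpret prob_space "coupling K" by (rule prob_space_coupling)
  note [measurable] = measurable_coupling_flow[OF \<open>k \<le> 0\<close>] measurable_coalesced[OF \<open>k \<le> 0\<close>]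
  have "pmf (transition K n k a) z - pmf (transition K n k b) z
    \<le> prob {\<xi> \<in> space (coupling K). \<not> coalesced n k \<xi>}" for a b
  proof -
    have "pmf (transition K n k a) z = prob {\<xi>\<in>space (coupling K). flow \<xi> n k a = z}"
      using assms by (simp add: measure_coupling_flow)
    also have "\<dots> \<le> prob ({\<xi>\<in>space (coupling K). flow \<xi> n k b = z}
        \<union> {\<xi> \<in> space (coupling K). \<not> coalesced n k \<xi>})"
      using sets_coupling_flow[OF \<open>k \<le> 0\<close>, of K "\<lambda>h. h b = z" n]
        sets_coupling_flow[OF \<open>k \<le> 0\<close>, of K "\<lambda>h. \<exists>x x'. h x \<noteq> h x'" n]
      by (intro finite_measure_mono sets.Un) (auto simp: coalesced_iff)
    also have "\<dots> \<le> prob {\<xi>\<in>space (coupling K). flow \<xi> n k b = z}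
        + prob {\<xi> \<in> space (coupling K). \<not> coalesced n k \<xi>}"
      using sets_coupling_flow[OF \<open>k \<le> 0\<close>, of K "\<lambda>h. h b = z" n]
        sets_coupling_flow[OF \<open>k \<le> 0\<close>, of K "\<lambda>h. \<exists>x x'. h x \<noteq> h x'" n]
      by (intro measure_Un_le) (auto simp: coalesced_iff)
    also have "prob {\<xi>\<in>space (coupling K). flow \<xi> n k b = z} = pmf (transition K n k b) z"
      using assms by (simp add: measure_coupling_flow)
    finally show ?thesis by simp
  qed
  from this[of x x'] this[of x' x] show ?thesis by linarith
qed

text \<open>
  The value of an absolute probability at time \<open>k\<close> is an average of rows of the transition matrix from \<open>n\<close>
  to \<open>k\<close>; if all rows nearly coincide, the weights of the average do not matter.
\<close>

lemma coalescing_imp_unique_absolute_probs: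
  fixes K :: "int \<Rightarrow> 'e::finite \<Rightarrow> 'e pmf"
  assumes "coalescing K"
  shows "unique_absolute_probs K"
  unfolding unique_absolute_probs_def
proof (intro ballI allI impI pmf_eqI)
  fix q q' and k :: int and z
  assume q: "q \<in> absolute_probs K" "q' \<in> absolute_probs K" and k: "k \<le> 0"
  have "\<bar>pmf (q k) z - pmf (q' k) z\<bar> \<le> 0"
  proof (rule field_le_epsilon)
    fix \<epsilon> :: real assume "\<epsilon> > 0"
    then obtain n where n: "n < k"
      "measure (coupling K) {\<xi> \<in> space (coupling K). \<not> coalesced n k \<xi>} \<le> \<epsilon> / 2"
      using assms k unfolding coalescing_iff by (meson half_gt_zero)
    \<comment> \<open>The row of an arbitrary state serves as the common reference.\<close>
    define t where "t = pmf (transition K n k undefined) z"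
    have "\<bar>pmf (r k) z - t\<bar> \<le> \<epsilon> / 2" if "r \<in> absolute_probs K" for r
    proof -
      have "pmf (r k) z - t = (\<Sum>x\<in>UNIV. pmf (r n) x * (pmf (transition K n k x) z - t))"
        using absolute_probs_transition[OF that, of n k] n k
        by (simp add: pmf_bind_finite right_diff_distrib sum_subtractf sum_distrib_right[symmetric] sum_pmf_UNIV)
      also have "\<bar>\<dots>\<bar> \<le> (\<Sum>x\<in>UNIV. pmf (r n) x * (\<epsilon> / 2))"
      proof (rule order_trans[OF sum_abs], intro sum_mono)
        fix x
        have "\<bar>pmf (transition K n k x) z - t\<bar> \<le> \<epsilon> / 2"
          using transition_close_of_coalesced[of n k K x z undefined] n k by (simp add: t_def)
        then show "\<bar>pmf (r n) x * (pmf (transition K n k x) z - t)\<bar> \<le> pmf (r n) x * (\<epsilon> / 2)"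
          by (simp only: abs_mult abs_of_nonneg[OF pmf_nonneg] mult_left_mono pmf_nonneg)
      qed
      also have "\<dots> = \<epsilon> / 2"
        by (simp only: sum_distrib_right[symmetric] sum_pmf_UNIV mult_1)
      finally show ?thesis .
    qed
    from this[OF q(1)] this[OF q(2)] show "\<bar>pmf (q k) z - pmf (q' k) z\<bar> \<le> 0 + \<epsilon>"
      by linarith
  qed
  then show "pmf (q k) z = pmf (q' k) z" by simp
qed

section \<open>Cylinders, the past, and laws of Markov chains\<close>

definition is_markov_law ::
    "(int \<Rightarrow> 'e::finite \<Rightarrow> 'e pmf) \<Rightarrow> (int \<Rightarrow> 'e pmf) \<Rightarrow> (int \<Rightarrow> 'e) measure \<Rightarrow> bool" where
  "is_markov_law K q Q \<longleftrightarrow> prob_space Q \<and> sets Q = sets OmegaX \<and> markov_fdd K q Q"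

definition cyl :: "int \<Rightarrow> int \<Rightarrow> (int \<Rightarrow> 'e::finite) \<Rightarrow> (int \<Rightarrow> 'e) set" where
  "cyl n m w = {\<xi> \<in> space OmegaX. \<forall>k\<in>{n..m}. \<xi> k = w k}"

text \<open>
  The \<open>\<sigma>\<close>-algebra of events up to time \<open>m\<close> on the path space of the signal. A tail event
  is one that belongs to \<open>past m\<close> for every \<open>m \<le> 0\<close>.
\<close>

definition past :: "int \<Rightarrow> (int \<Rightarrow> 'e::finite) measure" where
  "past m = generated_algebra (space OmegaX) (\<lambda>n \<xi>. \<xi> n) (count_space UNIV) {..m}"

text \<open>
  Replacing the path after time \<open>m\<close> by a fixed path \<open>w\<close> turns every event into an event of
  the past of \<open>m\<close> by taking preimages, and leaves the events of the past of \<open>m\<close> unchanged. It is a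
  measurable way of taking sections of an event at a fixed future.
\<close>

definition splice_path :: "int \<Rightarrow> (int \<Rightarrow> 'e) \<Rightarrow> (int \<Rightarrow> 'e) \<Rightarrow> int \<Rightarrow> 'e" where
  "splice_path m w \<xi> = (\<lambda>k. if k \<le> m then \<xi> k else w k)"

lemma space_OmegaX: "space OmegaX = ({..0} \<rightarrow>\<^sub>E UNIV)"
  by (simp add: OmegaX_def space_PiM)

lemma space_past [simp]: "space (past m) = space OmegaX"
  by (auto simp: past_def generated_algebra_def intro!: space_measure_of)

lemma sets_past: "sets (past m)
    = sigma_sets (space OmegaX) (\<Union>i\<le>m. {(\<lambda>\<xi>. \<xi> i) -` B \<inter> space OmegaX | B. True})"
  unfolding past_def generated_algebra_def by (subst sets_measure_of) auto

lemma past_coord: "i \<le> m \<Longrightarrow> {\<xi> \<in> space OmegaX. \<xi> i \<in> B} \<in> sets (past m)"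
  unfolding sets_past by (rule sigma_sets.Basic) (auto simp: vimage_def Int_def)

lemma past_mono: "m \<le> m' \<Longrightarrow> sets (past m) \<subseteq> sets (past m')"
  unfolding sets_past by (rule sigma_sets_mono') force

lemma measurable_splice:
  assumes "w \<in> space OmegaX" "m \<le> 0"
  shows "splice_path m w \<in> measurable (past m) OmegaX"
  unfolding OmegaX_def splice_path_def
proof (rule measurable_PiM_single')
  show "(\<lambda>\<xi> k. if k \<le> m then \<xi> k else w k) \<in> space (past m) \<rightarrow> ({..0} \<rightarrow>\<^sub>E space (count_space UNIV))"
    using assms by (auto simp: space_OmegaX PiE_iff extensional_def)
  fix i :: int
  show "(\<lambda>\<xi>. if i \<le> m then \<xi> i else w i) \<in> measurable (past m) (count_space UNIV)"
  proof (cases "i \<le> m")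
    case True
    have "(\<lambda>\<xi>. \<xi> i) -` B \<inter> space OmegaX = {\<xi> \<in> space OmegaX. \<xi> i \<in> B}" for B :: "'a set"
      by auto
    with True past_coord[of i m] show ?thesis
      by (auto intro!: measurableI)
  qed simp
qed

lemma sets_past_0: "sets (past 0 :: (int \<Rightarrow> 'e::finite) measure) = sets OmegaX"
proof
  show "sets OmegaX \<subseteq> sets (past 0 :: (int \<Rightarrow> 'e) measure)"
  proof
    fix A :: "(int \<Rightarrow> 'e) set" assume A: "A \<in> sets OmegaX"
    have "splice_path 0 (\<lambda>_. undefined) -` A \<inter> space (past 0) \<in> sets (past 0)"
      by (rule measurable_sets[OF measurable_splice A])
        (auto simp: space_OmegaX PiE_iff extensional_def)
    also have "splice_path 0 (\<lambda>_. undefined) -` A \<inter> space (past 0) = A"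
    proof -
      have "splice_path 0 (\<lambda>_. undefined) \<xi> = \<xi>" if "\<xi> \<in> space OmegaX" for \<xi> :: "int \<Rightarrow> 'e"
        using that by (auto simp: splice_path_def space_OmegaX PiE_iff extensional_def)
      with sets.sets_into_space[OF A] show ?thesis by auto
    qed
    finally show "A \<in> sets (past 0)" .
  qed
  have "(\<lambda>\<xi>. \<xi> i) -` B \<inter> space OmegaX \<in> sets OmegaX" if "i \<le> 0" for i and B :: "'e set"
    using that unfolding OmegaX_def
    by (intro measurable_sets[of _ _ "count_space UNIV"] measurable_component_singleton) auto
  then show "sets (past 0) \<subseteq> (sets OmegaX :: (int \<Rightarrow> 'e) set set)"
    unfolding sets_past by (intro sets.sigma_sets_subset) auto
qed

lemma past_subset: "m \<le> 0 \<Longrightarrow> sets (past m) \<subseteq> sets OmegaX"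
  using past_mono[of m 0] by (simp add: sets_past_0)

lemma past_cyl: "cyl n m w \<in> sets (past m)"
proof -
  have "cyl n m w = {\<xi> \<in> space (past m). \<forall>k\<in>{n..m}. \<xi> k \<in> {w k}}"
    by (auto simp: cyl_def)
  also have "\<dots> \<in> sets (past m)"
    by (rule sets.sets_Collect_finite_All) (use past_coord[of _ m "{w _}"] in auto)
  finally show ?thesis .
qed

lemma sets_cyl: "m \<le> 0 \<Longrightarrow> cyl n m w \<in> sets OmegaX"
  using past_cyl past_subset by blast

text \<open>
  Events of the past do not look at later coordinates: the sets with this invariance form a
  \<open>\<sigma>\<close>-algebra that contains the generators.
\<close>

lemma past_splice_iff:
  assumes "A \<in> sets (past m)" and w: "w \<in> space OmegaX" and "m \<le> 0" "\<xi> \<in> space OmegaX"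
  shows "splice_path m w \<xi> \<in> A \<longleftrightarrow> \<xi> \<in> A"
proof -
  have space: "splice_path m w \<xi> \<in> space OmegaX" if "\<xi> \<in> space OmegaX" for \<xi>
    using w that \<open>m \<le> 0\<close> by (auto simp: splice_path_def space_OmegaX PiE_iff extensional_def)
  from assms(1) have "\<forall>\<xi>\<in>space OmegaX. splice_path m w \<xi> \<in> A \<longleftrightarrow> \<xi> \<in> A"
    unfolding sets_past
  proof (induction rule: sigma_sets.induct)
    case (Basic a)
    then show ?case using space by (auto simp: splice_path_def)
  qed (use space in auto)
  with assms show ?thesis by blast
qed

text \<open>
  A basic set of the product \<open>\<sigma>\<close>-algebra restricts finitely many coordinates and is a finite disjoint
  union of cylinders that fix the whole path from some time \<open>n \<le> c\<close> on, because the state space is finite.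
  The bound \<open>c\<close> allows one to consider long cylinders only.
\<close>

lemma OmegaX_measure_eqI:
  fixes N N' :: "(int \<Rightarrow> 'e::finite) measure"
  assumes sets: "sets N = sets OmegaX" "sets N' = sets OmegaX" and fin: "finite_measure N"
    and eq: "\<And>n w. n \<le> c \<Longrightarrow> emeasure N (cyl n 0 w) = emeasure N' (cyl n 0 w)"
  shows "N = N'"
proof (rule measure_eqI_PiM_infinite[of N "{..0}" "\<lambda>_. count_space UNIV" N'])
  show "sets N = sets (PiM {..0} (\<lambda>_. count_space UNIV))" "sets N' = sets (PiM {..0} (\<lambda>_. count_space UNIV))"
    using sets by (simp_all add: OmegaX_def)
  fix A :: "int \<Rightarrow> 'e set" and J :: "int set" assume J: "finite J" "J \<subseteq> {..0}"
  define n where "n = Min (insert c J)"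
  have n: "n \<le> c" "J \<subseteq> {n..0}"
    using J by (auto simp: n_def)
  define W where "W = {w \<in> {n..0} \<rightarrow>\<^sub>E (UNIV :: 'e set). \<forall>j\<in>J. w j \<in> A j}"
  have fin_W: "finite W"
    unfolding W_def by (rule finite_subset[OF _ finite_PiE[of "{n..0}" "\<lambda>_. UNIV :: 'e set"]]) auto
  have disj: "disjoint_family_on (cyl n 0) W"
    unfolding disjoint_family_on_def
  proof (intro ballI impI, rule ccontr)
    fix w w' assume w: "w \<in> W" "w' \<in> W" "w \<noteq> w'" and "cyl n 0 w \<inter> cyl n 0 w' \<noteq> {}"
    then have "w k = w' k" if "k \<in> {n..0}" for k
      using that by (auto simp: cyl_def)
    then have "w = w'"
      using w(1,2) unfolding W_def by (intro PiE_ext[of w "{n..0}" "\<lambda>_. UNIV"]) auto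
    with w(3) show False ..
  qed
  have "prod_emb {..0} (\<lambda>_. count_space UNIV) J (Pi\<^sub>E J A) = {\<xi> \<in> space OmegaX. \<forall>j\<in>J. \<xi> j \<in> A j}"
    using J by (auto simp: space_OmegaX prod_emb_def PiE_iff extensional_def)
  also have "\<dots> = (\<Union>w\<in>W. cyl n 0 w)"
  proof (intro set_eqI iffI)
    fix \<xi> assume \<xi>: "\<xi> \<in> {\<xi> \<in> space OmegaX. \<forall>j\<in>J. \<xi> j \<in> A j}"
    then have "restrict \<xi> {n..0} \<in> W" "\<xi> \<in> cyl n 0 (restrict \<xi> {n..0})"
      using n by (auto simp: W_def cyl_def)
    then show "\<xi> \<in> (\<Union>w\<in>W. cyl n 0 w)" by blast
  next
    fix \<xi> assume "\<xi> \<in> (\<Union>w\<in>W. cyl n 0 w)"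
    then obtain w where w: "w \<in> W" "\<xi> \<in> cyl n 0 w" by blast
    have "\<xi> j \<in> A j" if "j \<in> J" for j
    proof -
      have "\<xi> j = w j"
        using w(2) that n(2) by (auto simp: cyl_def)
      then show ?thesis
        using w(1) that by (simp add: W_def)
    qed
    then show "\<xi> \<in> {\<xi> \<in> space OmegaX. \<forall>j\<in>J. \<xi> j \<in> A j}"
      using w(2) by (simp add: cyl_def)
  qed
  finally have emb: "prod_emb {..0} (\<lambda>_. count_space UNIV) J (Pi\<^sub>E J A) = (\<Union>w\<in>W. cyl n 0 w)" .
  have "emeasure R (\<Union>w\<in>W. cyl n 0 w) = (\<Sum>w\<in>W. emeasure R (cyl n 0 w))"
    if "sets R = sets OmegaX" for R
  proof (rule sum_emeasure[symmetric, OF _ disj fin_W])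
    show "cyl n 0 ` W \<subseteq> sets R"
      unfolding that by (intro image_subsetI sets_cyl) simp
  qed
  then show "emeasure N (prod_emb {..0} (\<lambda>_. count_space UNIV) J (Pi\<^sub>E J A))
      = emeasure N' (prod_emb {..0} (\<lambda>_. count_space UNIV) J (Pi\<^sub>E J A))"
    unfolding emb using sets eq[OF n(1)] by simp
qed (rule fin)

lemma is_markov_lawD:
  assumes "is_markov_law K q Q"
  shows "prob_space Q" "sets Q = sets OmegaX" "space Q = space OmegaX"
    and "n \<le> 0 \<Longrightarrow> measure Q (cyl n 0 w) = pmf (q n) (w n) * (\<Prod>k\<in>{n+1..0}. pmf (K k (w (k - 1))) (w k))"
  using assms sets_eq_imp_space_eq[of Q OmegaX]
  by (auto simp: is_markov_law_def markov_fdd_def cyl_def)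

lemma is_markov_law_unique:
  assumes "is_markov_law K q Q" "is_markov_law K q' Q'" and "\<And>n. n \<le> 0 \<Longrightarrow> q n = q' n"
  shows "Q = Q'"
proof -
  interpret Q: prob_space Q by (rule is_markov_lawD[OF assms(1)])
  interpret Q': prob_space Q' by (rule is_markov_lawD[OF assms(2)])
  show ?thesis
  proof (rule OmegaX_measure_eqI[where c=0])
    fix n :: int and w :: "int \<Rightarrow> 'a" assume "n \<le> 0"
    then show "emeasure Q (cyl n 0 w) = emeasure Q' (cyl n 0 w)"
      using assms by (simp add: Q.emeasure_eq_measure Q'.emeasure_eq_measure is_markov_lawD(4))
  qed (use is_markov_lawD(2)[OF assms(1)] is_markov_lawD(2)[OF assms(2)] in \<open>auto intro: Q.finite_measure_axioms\<close>)
qed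

text \<open>
  Dropping the last coordinate of a cylinder amounts to summing over it, and the rows of the kernels sum to
  one.
\<close>

lemma markov_marginal:
  assumes Q: "is_markov_law K q Q" and "n \<le> m" "m \<le> 0"
  shows "measure Q (cyl n m w) = pmf (q n) (w n) * (\<Prod>k\<in>{n+1..m}. pmf (K k (w (k - 1))) (w k))"
proof -
  interpret prob_space Q by (rule is_markov_lawD[OF Q])
  from \<open>m \<le> 0\<close> \<open>n \<le> m\<close> show ?thesis
  proof (induction m arbitrary: w rule: int_le_induct)
    case base
    then show ?case using is_markov_lawD(4)[OF Q] by simp
  next
    case (step m)
    let ?P = "pmf (q n) (w n) * (\<Prod>k\<in>{n+1..m-1}. pmf (K k (w (k - 1))) (w k))"
    have "cyl n (m - 1) w = (\<Union>z\<in>UNIV. cyl n m (w(m := z)))"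
    proof (intro set_eqI iffI)
      fix \<xi> assume "\<xi> \<in> cyl n (m - 1) w"
      then have "\<xi> \<in> cyl n m (w(m := \<xi> m))"
        by (auto simp: cyl_def)
      then show "\<xi> \<in> (\<Union>z\<in>UNIV. cyl n m (w(m := z)))" by blast
    next
      fix \<xi> assume "\<xi> \<in> (\<Union>z\<in>UNIV. cyl n m (w(m := z)))"
      then obtain z where z: "\<xi> \<in> space OmegaX" "\<forall>k\<in>{n..m}. \<xi> k = (w(m := z)) k"
        by (auto simp: cyl_def)
      have "\<xi> k = w k" if "k \<in> {n..m-1}" for k
        using z(2)[rule_format, of k] that by simp
      with z(1) show "\<xi> \<in> cyl n (m - 1) w"
        by (simp add: cyl_def)
    qed
    then have "measure Q (cyl n (m - 1) w) = measure Q (\<Union>z\<in>UNIV. cyl n m (w(m := z)))"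
      by (rule arg_cong)
    also have "\<dots> = (\<Sum>z\<in>UNIV. measure Q (cyl n m (w(m := z))))"
    proof (rule finite_measure_finite_Union)
      show "range (\<lambda>z. cyl n m (w(m := z))) \<subseteq> sets Q"
        using step.hyps sets_cyl is_markov_lawD(2)[OF Q] by auto
      show "disjoint_family_on (\<lambda>z. cyl n m (w(m := z))) UNIV"
        unfolding disjoint_family_on_def
      proof (intro ballI impI, rule ccontr)
        fix z z' assume "z \<noteq> z'" "cyl n m (w(m := z)) \<inter> cyl n m (w(m := z')) \<noteq> {}"
        then obtain \<xi> where "\<forall>k\<in>{n..m}. \<xi> k = (w(m := z)) k" "\<forall>k\<in>{n..m}. \<xi> k = (w(m := z')) k"
          by (auto simp: cyl_def)
        from bspec[OF this(1), of m] bspec[OF this(2), of m] \<open>z \<noteq> z'\<close> step.prems show False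
          by simp
      qed
    qed simp
    also have "\<dots> = (\<Sum>z\<in>UNIV. ?P * pmf (K m (w (m - 1))) z)"
    proof (rule sum.cong[OF refl])
      fix z
      have ivl: "{n+1..m} = insert m {n+1..m-1}"
        using step.prems by auto
      have "(\<Prod>k\<in>{n+1..m-1}. pmf (K k ((w(m := z)) (k - 1))) ((w(m := z)) k))
          = (\<Prod>k\<in>{n+1..m-1}. pmf (K k (w (k - 1))) (w k))"
        by (rule prod.cong) auto
      then have "(\<Prod>k\<in>{n+1..m}. pmf (K k ((w(m := z)) (k - 1))) ((w(m := z)) k))
          = pmf (K m (w (m - 1))) z * (\<Prod>k\<in>{n+1..m-1}. pmf (K k (w (k - 1))) (w k))"
        unfolding ivl by (subst prod.insert) auto
      with step show "measure Q (cyl n m (w(m := z))) = ?P * pmf (K m (w (m - 1))) z"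
        by simp
    qed
    also have "\<dots> = ?P"
      by (simp only: sum_distrib_left[symmetric] sum_pmf_UNIV mult_1_right)
    finally show ?case .
  qed
qed

text \<open>
  Both sides are finite measures in \<open>A\<close>. To compare them for \<open>A\<close> in the past of \<open>m\<close> it suffices to treat
  cylinders: pushing both measures forward along the map that freezes the path after time \<open>m\<close> yields measures
  on the full path space, where cylinders determine a measure, and does not affect events of the past.
\<close>

lemma markov_property_in_space:
  assumes Q: "is_markov_law K q Q" and "m < 0" and A: "A \<in> sets (past m)"
  shows "measure Q (A \<inter> {\<xi> \<in> space OmegaX. \<xi> m = e \<and> \<xi> (m + 1) = z})
    = measure Q (A \<inter> {\<xi> \<in> space OmegaX. \<xi> m = e}) * pmf (K (m + 1) e) z"
proof -
  interpret prob_space Q by (rule is_markov_lawD[OF Q])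
  note sets_Q = is_markov_lawD(2)[OF Q] and space_Q = is_markov_lawD(3)[OF Q]
  define c where "c = pmf (K (m + 1) e) z"
  define D where "D = {\<xi> \<in> space OmegaX. \<xi> m = e}"
  define D' where "D' = {\<xi> \<in> space OmegaX. \<xi> m = e \<and> \<xi> (m + 1) = z}"
  have D: "D \<in> sets Q" "D' \<in> sets Q"
  proof -
    have 1: "{\<xi> \<in> space OmegaX. \<xi> m \<in> {e}} \<in> sets Q" "{\<xi> \<in> space OmegaX. \<xi> (m + 1) \<in> {z}} \<in> sets Q"
      using \<open>m < 0\<close> past_coord[of m 0 "{e}"] past_coord[of "m + 1" 0 "{z}"]
      by (auto simp: sets_Q sets_past_0)
    then show "D \<in> sets Q" by (simp add: D_def)
    have "D' = {\<xi> \<in> space OmegaX. \<xi> m \<in> {e}} \<inter> {\<xi> \<in> space OmegaX. \<xi> (m + 1) \<in> {z}}"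
      by (auto simp: D'_def)
    then show "D' \<in> sets Q" using 1 by (simp only: sets.Int)
  qed
  define w\<^sub>0 where "w\<^sub>0 = (\<lambda>k\<in>{..0::int}. e)"
  have w\<^sub>0: "w\<^sub>0 \<in> space OmegaX"
    by (auto simp: w\<^sub>0_def space_OmegaX)
  let ?s = "splice_path m w\<^sub>0"
  have pre_past: "?s -` B \<inter> space OmegaX \<in> sets (past m)" if "B \<in> sets OmegaX" for B
    using measurable_sets[OF measurable_splice that, of w\<^sub>0 m] w\<^sub>0 \<open>m < 0\<close> by simp
  then have pre: "?s -` B \<inter> space OmegaX \<in> sets Q" if "B \<in> sets OmegaX" for B
    using that past_subset[of m] \<open>m < 0\<close> by (auto simp: sets_Q)
  have s: "?s \<in> measurable Q OmegaX"
    using measurable_space[OF measurable_splice, of w\<^sub>0 m] w\<^sub>0 \<open>m < 0\<close> pre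
    by (intro measurableI) (auto simp: space_Q)
  \<comment> \<open>\<open>N S\<close> sends \<open>B\<close> to the probability of \<open>S\<close> together with the event that the frozen path lies in \<open>B\<close>.\<close>
  define N where "N S = distr (density Q (indicator S)) OmegaX ?s" for S
  have N: "emeasure (N S) B = emeasure Q (S \<inter> (?s -` B \<inter> space OmegaX))"
    if "S \<in> sets Q" "B \<in> sets OmegaX" for S B
    using that s pre[OF that(2)]
    by (simp add: N_def emeasure_distr emeasure_restricted space_Q)
  have "N D' = scale_measure (ennreal c) (N D)"
  proof (rule OmegaX_measure_eqI[where c=m])
    show "finite_measure (N D')"
      by (intro finite_measureI) (use N[OF D(2), of "space OmegaX"] in \<open>auto simp: N_def emeasure_eq_measure\<close>)
    fix n and w :: "int \<Rightarrow> 'a" assume "n \<le> m"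
    let ?S = "?s -` cyl n 0 w \<inter> space OmegaX"
    show "emeasure (N D') (cyl n 0 w) = emeasure (scale_measure (ennreal c) (N D)) (cyl n 0 w)"
    \<comment> \<open>A frozen path lies in the cylinder of \<open>w\<close> only if \<open>w\<close> follows \<open>w\<^sub>0\<close> after time \<open>m\<close>.\<close>
    proof (cases "w m = e \<and> (\<forall>k\<in>{m+1..0}. w k = w\<^sub>0 k)")
      case True
      have "(\<forall>k\<in>{n..0}. ?s \<xi> k = w k) \<longleftrightarrow> (\<forall>k\<in>{n..m}. \<xi> k = w k)" for \<xi>
      proof (intro iffI ballI)
        fix k assume "\<forall>k\<in>{n..0}. ?s \<xi> k = w k" "k \<in> {n..m}"
        from bspec[OF this(1), of k] this(2) \<open>m < 0\<close> show "\<xi> k = w k"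
          by (simp add: splice_path_def)
      next
        fix k assume "\<forall>k\<in>{n..m}. \<xi> k = w k" "k \<in> {n..0}"
        with True show "?s \<xi> k = w k"
          by (cases "k \<le> m") (auto simp: splice_path_def)
      qed
      then have "?S = cyl n m w"
        using measurable_space[OF s] by (auto simp: cyl_def space_Q)
      then have "D' \<inter> ?S = cyl n (m + 1) (w(m + 1 := z))" "D \<inter> ?S = cyl n m w"
        using True \<open>n \<le> m\<close> by (auto simp: D_def D'_def cyl_def)
      moreover have "measure Q (cyl n (m + 1) (w(m + 1 := z))) = c * measure Q (cyl n m w)"
      proof -
        have ivl: "{n+1..m+1} = insert (m+1) {n+1..m}"
          using \<open>n \<le> m\<close> by auto
        have "(\<Prod>k\<in>{n+1..m}. pmf (K k ((w(m+1 := z)) (k - 1))) ((w(m+1 := z)) k))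
            = (\<Prod>k\<in>{n+1..m}. pmf (K k (w (k - 1))) (w k))"
          by (rule prod.cong) auto
        then have "(\<Prod>k\<in>{n+1..m+1}. pmf (K k ((w(m+1 := z)) (k - 1))) ((w(m+1 := z)) k))
            = c * (\<Prod>k\<in>{n+1..m}. pmf (K k (w (k - 1))) (w k))"
          unfolding ivl using True by (subst prod.insert) (auto simp: c_def)
        then show ?thesis
          using \<open>n \<le> m\<close> \<open>m < 0\<close> by (simp add: markov_marginal[OF Q])
      qed
      ultimately show ?thesis
        using N[OF D(1), of "cyl n 0 w"] N[OF D(2), of "cyl n 0 w"]
        by (simp add: sets_cyl emeasure_eq_measure ennreal_mult[symmetric] c_def)
    next
      case False
      then have "D' \<inter> ?S = {}" "D \<inter> ?S = {}"
        using \<open>n \<le> m\<close> \<open>m < 0\<close> by (force simp: D_def D'_def cyl_def splice_path_def)+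
      then show ?thesis
        using N[OF D(1), of "cyl n 0 w"] N[OF D(2), of "cyl n 0 w"] by (simp add: sets_cyl)
    qed
  qed (simp_all add: N_def)
  moreover have A': "A \<in> sets OmegaX"
    using A past_subset[of m] \<open>m < 0\<close> by auto
  moreover have "?s -` A \<inter> space OmegaX = A"
    using past_splice_iff[OF A w\<^sub>0] \<open>m < 0\<close> sets.sets_into_space[OF A'] by auto
  ultimately have "emeasure Q (D' \<inter> A) = ennreal c * emeasure Q (D \<inter> A)"
    using N[OF D(1) A'] N[OF D(2) A'] by simp
  then have "measure Q (D' \<inter> A) = c * measure Q (D \<inter> A)"
    by (simp add: emeasure_eq_measure c_def ennreal_mult[symmetric] measure_nonneg)
  then show ?thesis
    by (simp add: D_def D'_def c_def Int_commute mult.commute)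
qed

section \<open>The Markov property and the zero-one law of the tail\<close>

lemma finite_measure_eq_sum_fibres:
  fixes f :: "'a \<Rightarrow> 'b::finite"
  assumes "finite_measure Q" "A \<in> sets Q" "\<And>b. A \<inter> {\<xi>. f \<xi> = b} \<in> sets Q"
  shows "measure Q A = (\<Sum>b\<in>UNIV. measure Q (A \<inter> {\<xi>. f \<xi> = b}))"
proof -
  have "A = (\<Union>b\<in>UNIV. A \<inter> {\<xi>. f \<xi> = b})" by auto
  then have "measure Q A = measure Q (\<Union>b\<in>UNIV. A \<inter> {\<xi>. f \<xi> = b})" by (rule arg_cong)
  also have "\<dots> = (\<Sum>b\<in>UNIV. measure Q (A \<inter> {\<xi>. f \<xi> = b}))"
    using assms by (intro finite_measure.finite_measure_finite_Union) (auto simp: disjoint_family_on_def)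
  finally show ?thesis .
qed

lemma past_Int_coord: "A \<in> sets (past m) \<Longrightarrow> i \<le> m \<Longrightarrow> A \<inter> {\<xi>. \<xi> i = e} \<in> sets (past m)"
proof -
  assume A: "A \<in> sets (past m)" "i \<le> m"
  then have "A \<inter> {\<xi>. \<xi> i = e} = A \<inter> {\<xi> \<in> space OmegaX. \<xi> i \<in> {e}}"
    using sets.sets_into_space[OF A(1)] by auto
  with A past_coord[of i m "{e}"] show ?thesis by simp
qed

lemma markov_property:
  assumes Q: "is_markov_law K q Q" and m: "m < 0" and A: "A \<in> sets (past m)"
  shows "measure Q (A \<inter> {\<xi>. \<xi> m = e} \<inter> {\<xi>. \<xi> (m + 1) = z})
    = measure Q (A \<inter> {\<xi>. \<xi> m = e}) * pmf (K (m + 1) e) z"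
proof -
  have "A \<inter> {\<xi>. \<xi> m = e} \<inter> {\<xi>. \<xi> (m + 1) = z} = A \<inter> {\<xi> \<in> space OmegaX. \<xi> m = e \<and> \<xi> (m + 1) = z}"
    "A \<inter> {\<xi>. \<xi> m = e} = A \<inter> {\<xi> \<in> space OmegaX. \<xi> m = e}"
    using sets.sets_into_space[OF A] by auto
  with markov_property_in_space[OF Q m A, of e z] show ?thesis
    by (simp only:)
qed

lemma markov_property_cyl:
  assumes Q: "is_markov_law K q Q" and "n \<le> m" "m \<le> 0" and A: "A \<in> sets (past n)"
  shows "measure Q (A \<inter> cyl n m w)
    = measure Q (A \<inter> {\<xi>. \<xi> n = w n}) * (\<Prod>k\<in>{n+1..m}. pmf (K k (w (k - 1))) (w k))"
  using \<open>n \<le> m\<close> \<open>m \<le> 0\<close>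
proof (induction m rule: int_ge_induct)
  case base
  have "A \<inter> cyl n n w = A \<inter> {\<xi>. \<xi> n = w n}"
    using sets.sets_into_space[OF A] by (auto simp: cyl_def)
  then show ?case by simp
next
  case (step m)
  have "{n+1..m+1} = insert (m+1) {n+1..m}" "{n..m+1} = insert (m+1) {n..m}"
    using step.hyps by auto
  note ivl = this
  have "A \<inter> cyl n m w \<in> sets (past m)"
    using A past_mono[of n m] past_cyl[of n m] step.hyps by blast
  moreover have "A \<inter> cyl n m w \<inter> {\<xi>. \<xi> m = w m} = A \<inter> cyl n m w"
    "A \<inter> cyl n (m + 1) w = A \<inter> cyl n m w \<inter> {\<xi>. \<xi> (m + 1) = w (m + 1)}"
    using step.hyps unfolding cyl_def ivl(2) by auto
  ultimately have "measure Q (A \<inter> cyl n (m + 1) w)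
      = measure Q (A \<inter> cyl n m w) * pmf (K (m + 1) (w m)) (w (m + 1))"
    using markov_property[OF Q, of m "A \<inter> cyl n m w" "w m" "w (m + 1)"] step.prems by simp
  with step show ?case
    unfolding ivl(1) by (subst prod.insert) auto
qed

text \<open>
  A tail event belongs to the past of every time, so conditioning on it does not disturb any transition: the
  conditioned chain is again a Markov chain with the same kernels, only its one-time laws change.
\<close>

lemma conditioned_on_tail_is_markov_law:
  fixes K :: "int \<Rightarrow> 'e::finite \<Rightarrow> 'e pmf"
  assumes Q: "is_markov_law K q Q" and A: "\<And>m. m \<le> 0 \<Longrightarrow> A \<in> sets (past m)"
    and pos: "measure Q A > 0"
  obtains r where "r \<in> absolute_probs K" "is_markov_law K r (uniform_measure Q A)"
proof
  interpret prob_space Q by (rule is_markov_lawD[OF Q])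
  note sets_Q = is_markov_lawD(2)[OF Q] and space_Q = is_markov_lawD(3)[OF Q]
  have A_Q: "A \<in> sets Q"
    using A[of 0] by (simp add: sets_past_0 sets_Q)
  have A_past: "A \<inter> {\<xi>. \<xi> i = e} \<in> sets (past m)" if "i \<le> m" "m \<le> 0" for i m e
    using A that by (intro past_Int_coord)
  have A_coord: "A \<inter> {\<xi>. \<xi> i = e} \<in> sets Q" if "i \<le> 0" for i e
    using A_past[of i 0] that by (simp add: sets_past_0 sets_Q)
  define v where "v n z = measure Q (A \<inter> {\<xi>. \<xi> n = z}) / measure Q A" for n z
  define r where "r n = embed_pmf (v n)" for n
  have sum_v: "(\<Sum>z\<in>UNIV. v n z) = 1" if "n \<le> 0" for n
    using finite_measure_eq_sum_fibres[OF finite_measure_axioms A_Q, of "\<lambda>\<xi>. \<xi> n"] A_coord that pos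
    by (simp add: v_def sum_divide_distrib[symmetric])
  have r: "pmf (r n) z = v n z" if "n \<le> 0" for n z
    unfolding r_def using sum_v[OF that]
    by (intro pmf_embed_pmf) (auto simp: v_def nn_integral_count_space_finite sum_ennreal)
  show "r \<in> absolute_probs K"
    unfolding absolute_probs_def
  proof (intro CollectI allI impI)
    fix n :: int and z assume n: "n \<le> 0"
    have "A \<inter> {\<xi>. \<xi> n = z} \<inter> {\<xi>. \<xi> (n - 1) = e} \<in> sets Q" for e
      using past_Int_coord[OF A_past[of n 0 z], of "n - 1" e] n by (simp add: sets_past_0 sets_Q)
    then have "measure Q (A \<inter> {\<xi>. \<xi> n = z})
        = (\<Sum>e\<in>UNIV. measure Q (A \<inter> {\<xi>. \<xi> n = z} \<inter> {\<xi>. \<xi> (n - 1) = e}))"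
      using n by (intro finite_measure_eq_sum_fibres finite_measure_axioms A_coord)
    also have "\<dots> = (\<Sum>e\<in>UNIV. measure Q (A \<inter> {\<xi>. \<xi> (n - 1) = e}) * pmf (K n e) z)"
      using markov_property[OF Q, of "n - 1" A] A[of "n - 1"] n by (simp add: Int_ac)
    finally show "(\<Sum>e\<in>UNIV. pmf (r (n - 1)) e * pmf (K n e) z) = pmf (r n) z"
      using n by (simp add: r v_def sum_divide_distrib)
  qed
  have emeasure_A: "emeasure Q A \<noteq> 0" "emeasure Q A \<noteq> \<infinity>"
    using pos by (auto simp: emeasure_eq_measure)
  have "markov_fdd K r (uniform_measure Q A)"
    unfolding markov_fdd_def cyl_def[symmetric]
  proof (intro allI impI)
    fix n :: int and w :: "int \<Rightarrow> 'e" assume n: "n \<le> 0"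
    have "cyl n 0 w \<in> sets Q"
      by (simp add: sets_Q sets_cyl)
    then have "measure (uniform_measure Q A) (cyl n 0 w) = measure Q (A \<inter> cyl n 0 w) / measure Q A"
      using emeasure_A by (subst measure_uniform_measure) auto
    also have "\<dots> = v n (w n) * (\<Prod>k\<in>{n+1..0}. pmf (K k (w (k - 1))) (w k))"
      using markov_property_cyl[OF Q n _ A[OF n], of w] by (simp add: v_def)
    finally show "measure (uniform_measure Q A) (cyl n 0 w)
        = pmf (r n) (w n) * (\<Prod>k\<in>{n+1..0}. pmf (K k (w (k - 1))) (w k))"
      using n by (simp add: r)
  qed
  then show "is_markov_law K r (uniform_measure Q A)"
    using emeasure_A by (auto simp: is_markov_law_def sets_Q intro!: prob_space_uniform_measure)
qed

text \<open>
  Conditioning on a tail event of positive probability gives a Markov law for the same kernels. If there is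
  only one, it is the original law, which then gives the event probability one.
\<close>

lemma tail_zero_one:
  assumes unique: "unique_absolute_probs K" and q: "q \<in> absolute_probs K"
    and Q: "is_markov_law K q Q" and A: "\<And>m. m \<le> 0 \<Longrightarrow> A \<in> sets (past m)"
  shows "measure Q A = (measure Q A)\<^sup>2"
proof (cases "measure Q A > 0")
  case True
  interpret prob_space Q by (rule is_markov_lawD[OF Q])
  have A_Q: "A \<in> sets Q"
    using A[of 0] is_markov_lawD(2)[OF Q] by (simp add: sets_past_0)
  obtain r where r: "r \<in> absolute_probs K" "is_markov_law K r (uniform_measure Q A)"
    using conditioned_on_tail_is_markov_law[OF Q A True] by blast
  then have "uniform_measure Q A = Q"
    using unique q by (intro is_markov_law_unique[OF r(2) Q]) (auto simp: unique_absolute_probs_def)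
  moreover have "measure (uniform_measure Q A) A = 1"
    using True A_Q by (subst measure_uniform_measure) (auto simp: emeasure_eq_measure)
  ultimately show ?thesis by simp
qed (simp add: zero_less_measure_iff)

section \<open>A Markov law is determined by its kernels and the tail\<close>

text \<open>
  Both laws use the same kernel for the step from \<open>m\<close> to \<open>m + 1\<close>. Once an event of the past of \<open>m + 1\<close>
  is split according to the states at times \<open>m\<close> and \<open>m + 1\<close>, the Markov property reduces its probability under
  either law to probabilities of events of the past of \<open>m\<close>, with the same coefficients.
\<close>

lemma domination_extends_one_step:
  fixes K :: "int \<Rightarrow> 'e::finite \<Rightarrow> 'e pmf"
  assumes Q: "is_markov_law K q Q" and Q': "is_markov_law K q' Q'" and m: "m < 0"
    and Y: "Y \<in> sets (past m)"
    and dom: "\<And>C. C \<in> sets (past m) \<Longrightarrow> C \<subseteq> Y \<Longrightarrow> measure Q' C \<le> measure Q C"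
    and C: "C \<in> sets (past (m + 1))" "C \<subseteq> Y"
  shows "measure Q' C \<le> measure Q C"
proof -
  define w where "w z = (\<lambda>k\<in>{..0::int}. z)" for z :: 'e
  have w: "w z \<in> space OmegaX" for z
    by (auto simp: w_def space_OmegaX)
  have C_X: "C \<in> sets OmegaX"
    using C past_subset[of "m + 1"] m by auto
  \<comment> \<open>\<open>B z\<close> belongs to the past of \<open>m\<close> and agrees with \<open>C\<close> on the paths that are in state \<open>z\<close> at time \<open>m + 1\<close>.\<close>
  define B where "B z = splice_path m (w z) -` C \<inter> space OmegaX \<inter> Y" for z
  have B: "B z \<in> sets (past m)" for z
    using measurable_sets[OF measurable_splice[OF w, of m] C_X] m Y by (auto simp: B_def)
  have fibre: "C \<inter> {\<xi>. \<xi> (m + 1) = z} = B z \<inter> {\<xi>. \<xi> (m + 1) = z}" for z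
  proof -
    have "\<xi> \<in> C \<longleftrightarrow> splice_path m (w z) \<xi> \<in> C" if "\<xi> \<in> space OmegaX" "\<xi> (m + 1) = z" for \<xi>
    proof -
      have "splice_path m (w z) \<xi> = splice_path (m + 1) (w z) \<xi>"
      proof
        fix k show "splice_path m (w z) \<xi> k = splice_path (m + 1) (w z) \<xi> k"
          using that m by (cases "k = m + 1") (auto simp: splice_path_def w_def)
      qed
      with past_splice_iff[OF C(1) w, of \<xi> z] that m show ?thesis by simp
    qed
    then show ?thesis
      using sets.sets_into_space[OF C_X] C(2) by (auto simp: B_def)
  qed
  have expand: "measure R C
      = (\<Sum>z\<in>UNIV. \<Sum>e\<in>UNIV. measure R (B z \<inter> {\<xi>. \<xi> m = e}) * pmf (K (m + 1) e) z)"
    if R: "is_markov_law K r R" for r R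
  proof -
    interpret prob_space R by (rule is_markov_lawD[OF R])
    note sets_R = is_markov_lawD(2)[OF R]
    have ev: "A \<inter> {\<xi>. \<xi> i = e} \<in> sets R" if "A \<in> sets R" "i \<le> 0" for A i e
      using past_Int_coord[of A 0 i e] that by (simp add: sets_R sets_past_0)
    have B_R: "B z \<in> sets R" for z
      using B[of z] past_subset[of m] m by (auto simp: sets_R)
    have "measure R C = (\<Sum>z\<in>UNIV. measure R (C \<inter> {\<xi>. \<xi> (m + 1) = z}))"
      using C_X m by (intro finite_measure_eq_sum_fibres finite_measure_axioms ev) (auto simp: sets_R)
    also have "\<dots> = (\<Sum>z\<in>UNIV. measure R (B z \<inter> {\<xi>. \<xi> (m + 1) = z}))"
      by (simp only: fibre)
    also have "\<dots> = (\<Sum>z\<in>UNIV. \<Sum>e\<in>UNIV. measure R (B z \<inter> {\<xi>. \<xi> (m + 1) = z} \<inter> {\<xi>. \<xi> m = e}))"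
      using B_R m by (intro sum.cong[OF refl] finite_measure_eq_sum_fibres finite_measure_axioms ev) auto
    also have "\<dots> = (\<Sum>z\<in>UNIV. \<Sum>e\<in>UNIV. measure R (B z \<inter> {\<xi>. \<xi> m = e} \<inter> {\<xi>. \<xi> (m + 1) = z}))"
      by (intro sum.cong[OF refl] arg_cong[where f="measure R"]) blast
    also have "\<dots> = (\<Sum>z\<in>UNIV. \<Sum>e\<in>UNIV. measure R (B z \<inter> {\<xi>. \<xi> m = e}) * pmf (K (m + 1) e) z)"
      by (simp only: markov_property[OF R m B])
    finally show ?thesis .
  qed
  show ?thesis
    unfolding expand[OF Q] expand[OF Q']
  proof (intro sum_mono mult_right_mono pmf_nonneg dom)
    show "B z \<inter> {\<xi>. \<xi> m = e} \<in> sets (past m)" for z e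
      by (rule past_Int_coord[OF B order_refl])
  qed (auto simp: B_def)
qed

lemma domination_extends:
  assumes Q: "is_markov_law K q Q" and Q': "is_markov_law K q' Q'" and m: "m \<le> 0"
    and Y: "Y \<in> sets (past m)"
    and dom: "\<And>C. C \<in> sets (past m) \<Longrightarrow> C \<subseteq> Y \<Longrightarrow> measure Q' C \<le> measure Q C"
    and C: "C \<in> sets OmegaX" "C \<subseteq> Y"
  shows "measure Q' C \<le> measure Q C"
proof -
  have "k \<le> 0 \<Longrightarrow> C \<in> sets (past k) \<Longrightarrow> C \<subseteq> Y \<Longrightarrow> measure Q' C \<le> measure Q C" if "m \<le> k" for k C
    using that
  proof (induction k arbitrary: C rule: int_ge_induct)
    case (step k)
    show ?case
    proof (rule domination_extends_one_step[OF Q Q'])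
      show "k < 0" using step.prems by simp
      then show "measure Q' D \<le> measure Q D" if "D \<in> sets (past k)" "D \<subseteq> Y" for D
        using that by (intro step.IH) auto
      show "Y \<in> sets (past k)"
        using Y past_mono[OF step.hyps] by blast
    qed (use step.prems in auto)
  qed (use dom in blast)
  from this[of 0 C] m C show ?thesis by (simp add: sets_past_0)
qed

text \<open>
  The positive set of a Hahn decomposition of \<open>Q - Q'\<close> on the past of \<open>m\<close> is a positive set on the whole path
  space, since domination extends from the past to all events. Hence the total variation of \<open>Q - Q'\<close> is
  attained on every past.
\<close>

lemma past_maximizer:
  assumes Q: "is_markov_law K q Q" and Q': "is_markov_law K q' Q'" and m: "m \<le> 0"
  obtains Y where "Y \<in> sets (past m)"
    "\<And>C. C \<in> sets OmegaX \<Longrightarrow> measure Q C - measure Q' C \<le> measure Q Y - measure Q' Y"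
proof -
  interpret Q: prob_space Q by (rule is_markov_lawD[OF Q])
  interpret Q': prob_space Q' by (rule is_markov_lawD[OF Q'])
  note sets_Q = is_markov_lawD(2)[OF Q] and sets_Q' = is_markov_lawD(2)[OF Q']
  have sub: "subalgebra Q (past m)" "subalgebra Q' (past m)"
    using past_subset[OF m] is_markov_lawD(2,3)[OF Q] is_markov_lawD(2,3)[OF Q']
    by (auto simp: subalgebra_def)
  have "\<exists>Y\<in>sets (restr_to_subalg Q (past m)).
     (\<forall>X\<in>sets (restr_to_subalg Q (past m)). X \<subseteq> Y \<longrightarrow>
        emeasure (restr_to_subalg Q' (past m)) X \<le> emeasure (restr_to_subalg Q (past m)) X) \<and>
     (\<forall>X\<in>sets (restr_to_subalg Q (past m)). X \<inter> Y = {} \<longrightarrow>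
        emeasure (restr_to_subalg Q (past m)) X \<le> emeasure (restr_to_subalg Q' (past m)) X)"
    using sub Q.finite_measure_axioms Q'.finite_measure_axioms
    by (intro finite_unsigned_Hahn_decomposition finite_measure_restr_to_subalg)
      (auto simp: sets_restr_to_subalg)
  then obtain Y where Y: "Y \<in> sets (past m)"
    and pos: "\<And>C. C \<in> sets (past m) \<Longrightarrow> C \<subseteq> Y \<Longrightarrow> measure Q' C \<le> measure Q C"
    and neg: "\<And>C. C \<in> sets (past m) \<Longrightarrow> C \<inter> Y = {} \<Longrightarrow> measure Q C \<le> measure Q' C"
    using sub by (auto simp: sets_restr_to_subalg emeasure_restr_to_subalg
        Q.emeasure_eq_measure Q'.emeasure_eq_measure)
  have Y_X: "Y \<in> sets OmegaX"
    using Y past_subset[OF m] by auto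
  have pos': "measure Q' C \<le> measure Q C" if "C \<in> sets OmegaX" "C \<subseteq> Y" for C
    by (rule domination_extends[OF Q Q' m Y pos that])
  have neg': "measure Q C \<le> measure Q' C" if "C \<in> sets OmegaX" "C \<inter> Y = {}" for C
  proof (rule domination_extends[OF Q' Q m _ _ that(1)])
    show "space (past m) - Y \<in> sets (past m)" using Y by (rule sets.compl_sets)
    show "C \<subseteq> space (past m) - Y"
      using sets.sets_into_space[OF that(1)] that(2) by auto
  qed (use neg in auto)
  have "measure Q C - measure Q' C \<le> measure Q Y - measure Q' Y" if C: "C \<in> sets OmegaX" for C
  proof -
    have *: "measure R C = measure R (C \<inter> Y) + measure R (C - Y)"
      "measure R Y = measure R (C \<inter> Y) + measure R (Y - C)"
      if "prob_space R" "sets R = sets OmegaX" for R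
    proof -
      interpret prob_space R by fact
      show "measure R C = measure R (C \<inter> Y) + measure R (C - Y)"
        using finite_measure_Diff'[of C Y] C Y_X that by simp
      show "measure R Y = measure R (C \<inter> Y) + measure R (Y - C)"
        using finite_measure_Diff'[of Y C] C Y_X that by (simp add: Int_commute)
    qed
    have "measure Q (C - Y) \<le> measure Q' (C - Y)" "measure Q' (Y - C) \<le> measure Q (Y - C)"
      using C Y_X by (auto intro!: neg' pos')
    with *[OF Q.prob_space_axioms sets_Q] *[OF Q'.prob_space_axioms sets_Q'] show ?thesis
      by linarith
  qed
  with Y show ?thesis by (rule that)
qed

text \<open>
  For \<open>j = 0, 1, \<dots>\<close> let \<open>Y\<^sub>j\<close> be a maximizer of \<open>\<nu> = Q - Q'\<close> in the past of \<open>-j\<close>. Maximizers are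
  closed under unions, by modularity of \<open>\<nu>\<close>, and under monotone limits, so the limit superior of
  \<open>Y\<^sub>j\<close> is a maximizer as well. It is a tail event, where \<open>\<nu>\<close> vanishes; so the maximum of \<open>\<nu>\<close> is zero.
\<close>

lemma markov_laws_agree_if_agree_on_tail:
  fixes K :: "int \<Rightarrow> 'e::finite \<Rightarrow> 'e pmf"
  assumes Q: "is_markov_law K q Q" and Q': "is_markov_law K q' Q'"
    and tail: "\<And>A. (\<And>m. m \<le> 0 \<Longrightarrow> A \<in> sets (past m)) \<Longrightarrow> measure Q A = measure Q' A"
    and C: "C \<in> sets OmegaX"
  shows "measure Q C = measure Q' C"
proof -
  interpret Q: prob_space Q by (rule is_markov_lawD[OF Q])
  interpret Q': prob_space Q' by (rule is_markov_lawD[OF Q'])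
  note sets_Q = is_markov_lawD(2)[OF Q] and sets_Q' = is_markov_lawD(2)[OF Q']
  note space_Q = is_markov_lawD(3)[OF Q] and space_Q' = is_markov_lawD(3)[OF Q']
  define \<nu> where "\<nu> A = measure Q A - measure Q' A" for A
  have "\<exists>Y. Y \<in> sets (past (- int j)) \<and> (\<forall>C\<in>sets OmegaX. \<nu> C \<le> \<nu> Y)" for j :: nat
    using past_maximizer[OF Q Q', of "- int j"] unfolding \<nu>_def by (metis neg_le_0_iff_le of_nat_0_le_iff)
  then obtain Y where Y: "\<And>j. Y j \<in> sets (past (- int j))"
    and max: "\<And>j C. C \<in> sets OmegaX \<Longrightarrow> \<nu> C \<le> \<nu> (Y j)"
    by metis
  have Y_X [simp]: "Y j \<in> sets OmegaX" for j
    using Y[of j] past_subset[of "- int j"] by auto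
  define d where "d = \<nu> (Y 0)"
  have le_d: "\<nu> A \<le> d" if "A \<in> sets OmegaX" for A
    using max[OF that] by (simp add: d_def)
  have Y_d: "\<nu> (Y j) = d" for j
    using max[of "Y 0" j] le_d[of "Y j"] by (simp add: d_def)
  \<comment> \<open>Modularity: \<open>\<nu> (A \<union> B) + \<nu> (A \<inter> B) = 2 d\<close>, and neither summand exceeds \<open>d\<close>.\<close>
  have Un_d: "\<nu> (A \<union> B) = d" if "A \<in> sets OmegaX" "B \<in> sets OmegaX" "\<nu> A = d" "\<nu> B = d" for A B
  proof -
    have "\<nu> (A \<union> B) + \<nu> (A \<inter> B) = \<nu> A + \<nu> B"
      using that Q.finite_measure_Union'[of A B] Q'.finite_measure_Union'[of A B]
        Q.finite_measure_Diff'[of B A] Q'.finite_measure_Diff'[of B A]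
      by (simp add: \<nu>_def sets_Q sets_Q' Int_commute)
    with that le_d[of "A \<union> B"] le_d[of "A \<inter> B"] show ?thesis by auto
  qed
  have U_d: "\<nu> (\<Union>i\<in>{j..}. Y i) = d" for j
  proof -
    define V where "V n = (\<Union>i\<in>{j..j+n}. Y i)" for n
    have V: "V n \<in> sets OmegaX" for n
      by (auto simp: V_def)
    have "\<nu> (V n) = d" for n
    proof (induction n)
      case (Suc n)
      have "{j..j + Suc n} = insert (j + Suc n) {j..j + n}" by auto
      then have "V (Suc n) = V n \<union> Y (j + Suc n)" by (auto simp: V_def)
      with Suc show ?case by (simp add: Un_d V Y_d)
    qed (simp add: V_def Y_d)
    moreover have "(\<lambda>n. \<nu> (V n)) \<longlonglongrightarrow> \<nu> (\<Union>n. V n)"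
      unfolding \<nu>_def using V
      by (intro tendsto_diff Q.finite_Lim_measure_incseq Q'.finite_Lim_measure_incseq)
        (auto simp: sets_Q sets_Q' V_def incseq_def; fastforce)+
    moreover have "(\<Union>n. V n) = (\<Union>i\<in>{j..}. Y i)"
    proof (intro set_eqI iffI)
      fix x assume "x \<in> (\<Union>i\<in>{j..}. Y i)"
      then obtain i where "i \<ge> j" "x \<in> Y i" by auto
      then have "x \<in> V (i - j)" by (auto simp: V_def)
      then show "x \<in> (\<Union>n. V n)" by blast
    qed (auto simp: V_def)
    ultimately show ?thesis by (simp add: LIMSEQ_const_iff)
  qed
  define U where "U j = (\<Union>i\<in>{j..}. Y i)" for j
  have U_past: "U j \<in> sets (past m)" if "- int j \<le> m" for j m
  proof -
    have "Y i \<in> sets (past m)" if "i \<ge> j" for i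
      using Y[of i] past_mono[of "- int i" m] that \<open>- int j \<le> m\<close> by auto
    then show ?thesis by (auto simp: U_def)
  qed
  have U_X: "U j \<in> sets OmegaX" for j
    using U_past[of j 0] by (simp add: sets_past_0)
  have dec: "decseq U"
    unfolding decseq_def U_def by (intro allI impI UN_mono) auto
  define L where "L = (\<Inter>j. U j)"
  have "(\<lambda>j. \<nu> (U j)) \<longlonglongrightarrow> \<nu> L"
    unfolding \<nu>_def L_def using U_X dec
    by (intro tendsto_diff Q.finite_Lim_measure_decseq Q'.finite_Lim_measure_decseq)
      (auto simp: sets_Q sets_Q')
  then have L_d: "\<nu> L = d"
    using U_d by (simp add: U_def LIMSEQ_const_iff)
  have "L \<in> sets (past m)" if "m \<le> 0" for m
  proof -
    \<comment> \<open>The intersection of a decreasing sequence does not change when its first members are omitted; the others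
      lie in the past of \<open>m\<close>.\<close>
    have "L = (\<Inter>j\<in>{nat (- m)..}. U j)"
    proof
      show "(\<Inter>j\<in>{nat (- m)..}. U j) \<subseteq> L"
        unfolding L_def
      proof (intro INT_greatest)
        fix j
        have "U (max j (nat (- m))) \<subseteq> U j"
          using dec by (auto simp: decseq_def)
        then show "(\<Inter>j\<in>{nat (- m)..}. U j) \<subseteq> U j" by force
      qed
    qed (auto simp: L_def)
    also have "\<dots> \<in> sets (past m)"
      using U_past by (intro sets.countable_INT') auto
    finally show ?thesis .
  qed
  then have "d = 0"
    using tail[of L] L_d by (simp add: \<nu>_def)
  then have "\<nu> C \<le> 0" "\<nu> (space OmegaX - C) \<le> 0"
    using le_d[of C] le_d[of "space OmegaX - C"] C by auto
  moreover have "\<nu> (space OmegaX - C) = - \<nu> C"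
    using Q.prob_compl[of C] Q'.prob_compl[of C] C by (simp add: \<nu>_def sets_Q sets_Q' space_Q space_Q')
  ultimately show ?thesis by (simp add: \<nu>_def)
qed

section \<open>Existence of Markov laws by time reversal\<close>

text \<open>
  The transition probabilities of the time-reversed chain, by the formula of Bayes; at time zero the law
  of the first state \<open>q 0\<close>, regardless of \<open>x\<close>. The value in states of probability zero is arbitrary.
\<close>

definition backward_kernel ::
    "(int \<Rightarrow> 'e::finite \<Rightarrow> 'e pmf) \<Rightarrow> (int \<Rightarrow> 'e pmf) \<Rightarrow> int \<Rightarrow> 'e \<Rightarrow> 'e pmf" where
  "backward_kernel K q n x =
     (if n < 0 \<and> pmf (q (n + 1)) x > 0
      then embed_pmf (\<lambda>e. pmf (q n) e * pmf (K (n + 1) e) x / pmf (q (n + 1)) x)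
      else q n)"

lemma pmf_backward_kernel:
  assumes q: "q \<in> absolute_probs K" and n: "n < 0"
  shows "pmf (backward_kernel K q n x) e * pmf (q (n + 1)) x = pmf (q n) e * pmf (K (n + 1) e) x"
proof -
  have "bind_pmf (q n) (K (n + 1)) = q (n + 1)"
    using q n by (auto simp: absolute_probs_iff dest!: spec[of _ "n + 1"])
  then have sum: "(\<Sum>e\<in>UNIV. pmf (q n) e * pmf (K (n + 1) e) x) = pmf (q (n + 1)) x"
    by (metis pmf_bind_finite)
  show ?thesis
  proof (cases "pmf (q (n + 1)) x > 0")
    case True
    then have "pmf (backward_kernel K q n x) e = pmf (q n) e * pmf (K (n + 1) e) x / pmf (q (n + 1)) x"
      using n sum unfolding backward_kernel_def
      by (simp, intro pmf_embed_pmf)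
        (auto simp: nn_integral_count_space_finite sum_ennreal sum_divide_distrib[symmetric])
    with True show ?thesis by simp
  next
    case False
    then have "pmf (q (n + 1)) x = 0"
      using pmf_nonneg[of "q (n + 1)" x] by linarith
    with sum have "(\<Sum>e\<in>UNIV. pmf (q n) e * pmf (K (n + 1) e) x) = 0"
      by simp
    then have "\<forall>e\<in>UNIV. pmf (q n) e * pmf (K (n + 1) e) x = 0"
      by (subst (asm) sum_nonneg_eq_0_iff) auto
    with \<open>pmf (q (n + 1)) x = 0\<close> show ?thesis by simp
  qed
qed

text \<open>
  The trajectory that runs backwards from time zero through independent maps. The argument
  \<^const>\<open>undefined\<close> of the first map stands for any state.
\<close>

primrec backward_state :: "(int \<Rightarrow> 'e \<Rightarrow> 'e) \<Rightarrow> nat \<Rightarrow> 'e" where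
  "backward_state \<xi> 0 = \<xi> 0 undefined"
| "backward_state \<xi> (Suc j) = \<xi> (- int (Suc j)) (backward_state \<xi> j)"

definition backward_path :: "(int \<Rightarrow> 'e \<Rightarrow> 'e) \<Rightarrow> int \<Rightarrow> 'e" where
  "backward_path \<xi> = (\<lambda>k\<in>{..0}. backward_state \<xi> (nat (- k)))"

lemma backward_path_step: "k < 0 \<Longrightarrow> backward_path \<xi> k = \<xi> k (backward_path \<xi> (k + 1))"
proof -
  assume "k < 0"
  then have "nat (- k) = Suc (nat (- (k + 1)))" and "- int (Suc (nat (- (k + 1)))) = k"
    by auto
  then have "backward_state \<xi> (nat (- k)) = \<xi> k (backward_state \<xi> (nat (- (k + 1))))"
    by (simp only: backward_state.simps)
  with \<open>k < 0\<close> show ?thesis by (simp add: backward_path_def)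
qed

lemma measurable_backward_state:
  fixes B :: "int \<Rightarrow> 'e::finite \<Rightarrow> 'e pmf"
  shows "(\<lambda>\<xi>. backward_state \<xi> j) \<in> measurable (coupling B) (count_space UNIV)"
proof (induction j)
  case 0
  show ?case
    using measurable_compose[OF measurable_coupling_coord[of 0 B], of "\<lambda>f. f undefined"] by simp
next
  case (Suc j)
  have "(\<lambda>\<xi>. \<xi> (- int (Suc j)) e) \<in> measurable (coupling B) (count_space UNIV)" for e
    by (rule measurable_compose[OF measurable_coupling_coord[of "- int (Suc j)" B], of "\<lambda>f. f e"]) auto
  then show ?case
    unfolding backward_state.simps
    by (rule measurable_compose_countable'[where f="\<lambda>e \<xi>. \<xi> (- int (Suc j)) e" and I=UNIV])
      (simp_all add: Suc countable_finite)
qed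

lemma measurable_backward_path: "backward_path \<in> measurable (coupling B) OmegaX"
  unfolding OmegaX_def backward_path_def[abs_def]
  by (rule measurable_restrict) (rule measurable_backward_state)

text \<open>
  Independent maps with the backward kernels form an instance of \<^const>\<open>coupling\<close>, and a path is determined by
  one value of each of them. So the probability of a cylinder is a product, which turns into the forward
  product by the formula of Bayes. The chain is built backwards because it has a first state only in that
  direction.
\<close>

lemma markov_law_exists:
  fixes K :: "int \<Rightarrow> 'e::finite \<Rightarrow> 'e pmf"
  assumes q: "q \<in> absolute_probs K"
  shows "is_markov_law K q (distr (coupling (backward_kernel K q)) OmegaX backward_path)"
    (is "is_markov_law K q ?Q")
proof -
  let ?B = "backward_kernel K q"
  interpret prob_space "coupling ?B" by (rule prob_space_coupling)
  have "prob_space ?Q"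
    by (intro prob_space_distr measurable_backward_path)
  moreover have "markov_fdd K q ?Q"
    unfolding markov_fdd_def cyl_def[symmetric]
  proof (intro allI impI)
    fix n :: int and x :: "int \<Rightarrow> 'e" assume n: "n \<le> 0"
    \<comment> \<open>Time one carries the fictitious argument of the map at time zero.\<close>
    define w where "w = x(1 := undefined)"
    have w: "w k = x k" if "k \<le> 0" for k
      using that by (simp add: w_def)
    have path_iff: "(\<forall>k\<in>{n..0}. backward_path \<xi> k = x k) \<longleftrightarrow> (\<forall>k\<in>{n..0}. \<xi> k (w (k + 1)) = w k)" for \<xi>
      using n
    proof (induction n rule: int_le_induct)
      case base
      show ?case by (simp add: backward_path_def w_def)
    next
      case (step n)
      have ivl: "{n - 1..0} = insert (n - 1) {n..0}"
        using step by auto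
      have "backward_path \<xi> (n - 1) = \<xi> (n - 1) (backward_path \<xi> n)"
        using step backward_path_step[of "n - 1" \<xi>] by simp
      moreover have "n \<in> {n..0}" using step by simp
      ultimately show ?case
        unfolding ivl ball_insert step.IH[symmetric] using w step.hyps by auto
    qed
    have "measure ?Q (cyl n 0 x) = measure (coupling ?B) (backward_path -` cyl n 0 x \<inter> space (coupling ?B))"
      by (intro measure_distr measurable_backward_path) (simp add: sets_cyl)
    also have "backward_path -` cyl n 0 x \<inter> space (coupling ?B)
        = {\<xi> \<in> space (coupling ?B). \<forall>k\<in>{n..0}. \<xi> k \<in> {f. f (w (k + 1)) = w k}}"
      using measurable_space[OF measurable_backward_path] path_iff by (auto simp: cyl_def)
    also have "measure (coupling ?B) \<dots> = (\<Prod>k\<in>{n..0}. pmf (?B k (w (k + 1))) (w k))"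
      by (subst measure_coupling_box) (auto simp: measure_random_map_single)
    also have "\<dots> = pmf (q n) (x n) * (\<Prod>k\<in>{n+1..0}. pmf (K k (x (k - 1))) (x k))"
      using n
    proof (induction n rule: int_le_induct)
      case base
      show ?case by (simp add: backward_kernel_def w)
    next
      case (step n)
      have ivl: "{n - 1..0} = insert (n - 1) {n..0}" "{n..0} = insert n {n+1..0}"
        using step by auto
      have "(\<Prod>k\<in>{n-1..0}. pmf (?B k (w (k + 1))) (w k))
        = pmf (?B (n - 1) (x n)) (x (n - 1)) * (pmf (q n) (x n) * (\<Prod>k\<in>{n+1..0}. pmf (K k (x (k - 1))) (x k)))"
        unfolding ivl(1) using step w by (subst prod.insert) auto
      also have "\<dots> = pmf (q (n - 1)) (x (n - 1)) * pmf (K n (x (n - 1))) (x n)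
          * (\<Prod>k\<in>{n+1..0}. pmf (K k (x (k - 1))) (x k))"
        using pmf_backward_kernel[OF q, of "n - 1" "x n" "x (n - 1)"] step by (simp add: mult.assoc[symmetric])
      also have "\<dots> = pmf (q (n - 1)) (x (n - 1)) * (\<Prod>k\<in>{n..0}. pmf (K k (x (k - 1))) (x k))"
        unfolding ivl(2) by (subst prod.insert) (auto simp: mult.assoc)
      finally show ?case by simp
    qed
    finally show "measure ?Q (cyl n 0 x) = pmf (q n) (x n) * (\<Prod>k\<in>{n+1..0}. pmf (K k (x (k - 1))) (x k))" .
  qed
  ultimately show ?thesis by (simp add: is_markov_law_def)
qed

lemma markov_law_eqI:
  assumes "is_markov_law K q Q"
  shows "markov_law K q = Q"
  unfolding markov_law_def is_markov_law_def[symmetric]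
proof (rule the_equality[where P="is_markov_law K q", OF assms])
  fix R assume "is_markov_law K q R"
  from is_markov_law_unique[OF this assms refl] show "R = Q" .
qed

lemma is_markov_law_markov_law:
  "q \<in> absolute_probs K \<Longrightarrow> is_markov_law K q (markov_law K q)"
  using markov_law_exists markov_law_eqI by metis

lemma coalescing_iff_unique_absolute_probs: "coalescing K \<longleftrightarrow> unique_absolute_probs K"
  using unique_absolute_probs_imp_coalescing coalescing_imp_unique_absolute_probs by blast

text \<open>
  The Markov laws of all absolute probabilities have the same restriction to the tail, hence they are equal, and
  so are their one-time marginals.
\<close>

lemma unique_absolute_probs_of_tail_agreement:
  fixes K :: "int \<Rightarrow> 'e::finite \<Rightarrow> 'e pmf"
  assumes agree: "\<And>A q. q \<in> absolute_probs K \<Longrightarrow> (\<And>m. m \<le> 0 \<Longrightarrow> A \<in> sets (past m)) \<Longrightarrow>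
    measure (markov_law K q) A = f A"
  shows "unique_absolute_probs K"
  unfolding unique_absolute_probs_def
proof (intro ballI allI impI pmf_eqI)
  fix q q' and n :: int and z assume q: "q \<in> absolute_probs K" "q' \<in> absolute_probs K" and n: "n \<le> 0"
  note laws = is_markov_law_markov_law[OF q(1)] is_markov_law_markov_law[OF q(2)]
  have "measure (markov_law K q) (cyl n n (\<lambda>_. z)) = measure (markov_law K q') (cyl n n (\<lambda>_. z))"
  proof (rule markov_laws_agree_if_agree_on_tail[OF laws])
    fix A :: "(int \<Rightarrow> 'e) set" assume A: "\<And>m. m \<le> 0 \<Longrightarrow> A \<in> sets (past m)"
    show "measure (markov_law K q) A = measure (markov_law K q') A"
      by (rule trans[OF agree[OF q(1) A] agree[OF q(2) A, symmetric]])
  qed (rule sets_cyl[OF n])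
  then show "pmf (q n) z = pmf (q' n) z"
    using n by (simp add: markov_marginal[OF laws(1)] markov_marginal[OF laws(2)])
qed

section \<open>Tail events on the product space and the equivalence\<close>

lemma space_Omega: "space (Omega :: ((int \<Rightarrow> 'e::finite) \<times> (int \<Rightarrow> 'f::polish_space)) measure)
    = space OmegaX \<times> space OmegaY"
  by (simp add: Omega_def space_pair_measure)

lemma space_OmegaY_nonempty: "space (OmegaY :: (int \<Rightarrow> 'f::polish_space) measure) \<noteq> {}"
  by (simp add: OmegaY_def space_PiM PiE_eq_empty_iff)

text \<open>
  Generating a \<open>\<sigma>\<close>-algebra commutes with taking preimages, here under the first projection.
\<close>

lemma sets_algX:
  "sets (algX {..m} :: ((int \<Rightarrow> 'e::finite) \<times> (int \<Rightarrow> 'f::polish_space)) measure)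
    = (\<lambda>B. B \<times> space OmegaY) ` sets (past m)"
proof -
  let ?\<Omega> = "space (Omega :: ((int \<Rightarrow> 'e) \<times> (int \<Rightarrow> 'f)) measure)"
  let ?G = "\<Union>i\<le>m. {(\<lambda>\<xi>. \<xi> i) -` B \<inter> space OmegaX | B. B \<in> (UNIV :: 'e set set)}"
  have "sets (algX {..m} :: ((int \<Rightarrow> 'e) \<times> (int \<Rightarrow> 'f)) measure)
      = sigma_sets ?\<Omega> (\<Union>i\<le>m. {coordX i -` B \<inter> ?\<Omega> | B. B \<in> (UNIV :: 'e set set)})"
    unfolding algX_def generated_algebra_def by (subst sets_measure_of) auto
  also have "(\<Union>i\<le>m. {coordX i -` B \<inter> ?\<Omega> | B. B \<in> (UNIV :: 'e set set)}) = {fst -` a \<inter> ?\<Omega> | a. a \<in> ?G}"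
  proof (intro set_eqI iffI)
    fix S assume "S \<in> (\<Union>i\<le>m. {coordX i -` B \<inter> ?\<Omega> | B. B \<in> (UNIV :: 'e set set)})"
    then obtain i B where i: "i \<le> m" "S = coordX i -` B \<inter> ?\<Omega>" by auto
    then have "S = fst -` ((\<lambda>\<xi>. \<xi> i) -` B \<inter> space OmegaX) \<inter> ?\<Omega>"
      by (auto simp: coordX_def space_Omega)
    with i(1) show "S \<in> {fst -` a \<inter> ?\<Omega> | a. a \<in> ?G}" by blast
  next
    fix S assume "S \<in> {fst -` a \<inter> ?\<Omega> | a. a \<in> ?G}"
    then obtain i B where i: "i \<le> m" "S = fst -` ((\<lambda>\<xi>. \<xi> i) -` B \<inter> space OmegaX) \<inter> ?\<Omega>" by auto
    then have "S = coordX i -` B \<inter> ?\<Omega>"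
      by (auto simp: coordX_def space_Omega)
    with i(1) show "S \<in> (\<Union>i\<le>m. {coordX i -` B \<inter> ?\<Omega> | B. B \<in> (UNIV :: 'e set set)})" by blast
  qed
  also have "sigma_sets ?\<Omega> {fst -` a \<inter> ?\<Omega> | a. a \<in> ?G}
      = {fst -` a \<inter> ?\<Omega> | a. a \<in> sigma_sets (space OmegaX) ?G}"
    by (rule sigma_sets_vimage_commute[symmetric]) (auto simp: space_Omega)
  also have "\<dots> = (\<lambda>B. B \<times> space OmegaY) ` sets (past m)"
  proof -
    have "fst -` a \<inter> ?\<Omega> = a \<times> space OmegaY" if "a \<in> sets (past m)" for a
      using sets.sets_into_space[OF that] by (auto simp: space_Omega)
    moreover have "sigma_sets (space OmegaX) ?G = sets (past m)"
      unfolding sets_past by simp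
    ultimately show ?thesis by auto
  qed
  finally show ?thesis .
qed

text \<open>
  The base of a cylinder is recovered by the first projection, as the path space of the observations is not
  empty; so one and the same base serves for all times.
\<close>

lemma tail_iff:
  fixes A :: "((int \<Rightarrow> 'e::finite) \<times> (int \<Rightarrow> 'f::polish_space)) set"
  shows "A \<in> (\<Inter>n\<in>{..0}. sets (algX {..n})) \<longleftrightarrow>
    (\<exists>B. (\<forall>m\<le>0. B \<in> sets (past m)) \<and> A = B \<times> space OmegaY)"
proof
  assume A: "A \<in> (\<Inter>n\<in>{..0}. sets (algX {..n}))"
  have "fst ` A \<in> sets (past m) \<and> A = fst ` A \<times> space OmegaY" if "m \<le> 0" for m
  proof -
    from A that obtain B where B: "B \<in> sets (past m)" "A = B \<times> space OmegaY"
      by (auto simp: sets_algX)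
    then have "fst ` A = B"
      using space_OmegaY_nonempty[where 'f='f] by simp
    with B show ?thesis by simp
  qed
  then show "\<exists>B. (\<forall>m\<le>0. B \<in> sets (past m)) \<and> A = B \<times> space OmegaY"
    by (meson order_refl)
qed (auto simp: sets_algX)

text \<open>
  The theorem for a fixed observation path. In the first direction all Markov laws for \<open>K\<close> coincide with \<open>Q\<close>
  and \<open>Q\<close> is trivial on the tail. In the second direction the value of \<open>Q\<close> on a tail event
  determines that of every other Markov law for \<open>K\<close>.
\<close>

lemma coalescing_iff_tail:
  fixes K :: "int \<Rightarrow> 'e::finite \<Rightarrow> 'e pmf"
  assumes q: "q \<in> absolute_probs K" and Q: "is_markov_law K q Q"
  shows "coalescing K \<longleftrightarrow>
    (\<forall>A \<in> (\<Inter>n\<in>{..0}. sets (algX {..n} :: ((int \<Rightarrow> 'e) \<times> (int \<Rightarrow> 'f::polish_space)) measure)).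
      \<forall>q' \<in> absolute_probs K. lifted_prob Q A = (lifted_prob Q A)\<^sup>2 \<and>
        (lifted_prob Q A)\<^sup>2 = lifted_prob (markov_law K q') A)"
    (is "_ \<longleftrightarrow> ?R")
proof
  assume "coalescing K"
  then have unique: "unique_absolute_probs K"
    by (simp add: coalescing_iff_unique_absolute_probs)
  show ?R
  proof (intro ballI)
    fix A :: "((int \<Rightarrow> 'e) \<times> (int \<Rightarrow> 'f)) set" and q'
    assume "A \<in> (\<Inter>n\<in>{..0}. sets (algX {..n}))" and q': "q' \<in> absolute_probs K"
    then obtain B where B: "\<And>m. m \<le> 0 \<Longrightarrow> B \<in> sets (past m)" and A: "A = B \<times> space OmegaY"
      unfolding tail_iff by blast
    have "markov_law K q' = Q"
      using unique q q'
      by (intro is_markov_law_unique[OF is_markov_law_markov_law[OF q'] Q])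
        (simp add: unique_absolute_probs_def)
    with tail_zero_one[OF unique q Q B]
    show "lifted_prob Q A = (lifted_prob Q A)\<^sup>2 \<and>
        (lifted_prob Q A)\<^sup>2 = lifted_prob (markov_law K q') A"
      by (simp add: A lifted_prob_Times)
  qed
next
  assume R: ?R
  have "unique_absolute_probs K"
  proof (rule unique_absolute_probs_of_tail_agreement)
    fix B :: "(int \<Rightarrow> 'e) set" and q' assume q': "q' \<in> absolute_probs K" and B: "\<And>m. m \<le> 0 \<Longrightarrow> B \<in> sets (past m)"
    have "B \<times> space (OmegaY :: (int \<Rightarrow> 'f) measure) \<in> (\<Inter>n\<in>{..0}. sets (algX {..n}))"
      using B unfolding tail_iff by blast
    from bspec[OF bspec[OF R this] q'] show "measure (markov_law K q') B = (measure Q B)\<^sup>2"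
      by (simp add: lifted_prob_Times)
  qed
  then show "coalescing K"
    by (simp add: coalescing_iff_unique_absolute_probs)
qed

theorem theorem3:
  fixes M :: "int \<Rightarrow> 'e::finite \<Rightarrow> 'e pmf"
    and g :: "int \<Rightarrow> 'e \<Rightarrow> 'f::polish_space \<Rightarrow> real"
    and \<psi> :: "'f measure"
    and p :: "int \<Rightarrow> 'e pmf"
    and P :: "((int \<Rightarrow> 'e) \<times> (int \<Rightarrow> 'f)) measure"
    and \<mu> :: "int \<Rightarrow> (int \<Rightarrow> 'f) \<Rightarrow> 'e pmf"
    and PX :: "(int \<Rightarrow> 'f) \<Rightarrow> (int \<Rightarrow> 'e) measure"
    and H' :: "(int \<Rightarrow> 'f) set"
  assumes psi: "sigma_finite_measure \<psi>" "sets \<psi> = sets borel"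
    and g_measurable: "\<And>n x. n \<le> 0 \<Longrightarrow> g n x \<in> borel_measurable borel"
    and g_nonneg: "\<And>n x z. n \<le> 0 \<Longrightarrow> 0 \<le> g n x z"
    and g_prob: "\<And>n x. n \<le> 0 \<Longrightarrow> prob_space (obs_kernel g \<psi> n x)"
    and p: "p \<in> absolute_probs M"
    and P: "hmm_law M g \<psi> p P"
    and mu_measurable: "\<And>n x. n \<le> 0 \<Longrightarrow> (\<lambda>y. pmf (\<mu> n y) x) \<in> borel_measurable OmegaY"
    and mu_cond: "\<And>n x. n \<le> 0 \<Longrightarrow>
      AE \<omega> in P. real_cond_exp P (algY {..0}) (indicator {\<omega> \<in> space P. coordX n \<omega> = x}) \<omega>
        = pmf (\<mu> n (snd \<omega>)) x"
    and mu_absolute: "\<And>n x. n \<le> 0 \<Longrightarrow>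
      AE \<omega> in P. (\<Sum>x'\<in>UNIV. pmf (\<mu> (n - 1) (snd \<omega>)) x' * pmf (cond_kernel M g (snd \<omega>) n x') x)
        = pmf (\<mu> n (snd \<omega>)) x"
    and PX_kernel: "PX \<in> measurable OmegaY (prob_algebra OmegaX)"
    and H': "H' \<in> sets OmegaY" "measure P {\<omega> \<in> space P. snd \<omega> \<in> H'} = 1"
    and PX_fdd: "\<And>y. y \<in> H' \<Longrightarrow> markov_fdd (cond_kernel M g y) (\<lambda>n. \<mu> n y) (PX y)"
  shows
    "(AE \<omega> in P. measure (coupling (cond_kernel M g (snd \<omega>)))
        {\<xi> \<in> space (coupling (cond_kernel M g (snd \<omega>))). \<forall>n\<le>0. coalescence_time n \<xi> > -\<infinity>} = 1)
     \<longleftrightarrow>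
     (\<exists>H \<in> sets P. measure P H = 1 \<and>
        (\<forall>\<omega>\<in>H. \<forall>A \<in> (\<Inter>n\<in>{..0}. sets (algX {..n} :: ((int \<Rightarrow> 'e) \<times> (int \<Rightarrow> 'f)) measure)).
          \<forall>q \<in> absolute_probs (cond_kernel M g (snd \<omega>)).
            lifted_prob (PX (snd \<omega>)) A = (lifted_prob (PX (snd \<omega>)) A)\<^sup>2 \<and>
            (lifted_prob (PX (snd \<omega>)) A)\<^sup>2 = lifted_prob (markov_law (cond_kernel M g (snd \<omega>)) q) A))"
    (is "(AE \<omega> in P. ?C \<omega>) \<longleftrightarrow> (\<exists>H\<in>sets P. measure P H = 1 \<and> (\<forall>\<omega>\<in>H. ?T \<omega>))")
proof -
  have sets_P: "sets P = sets Omega"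
    using P by (simp add: hmm_law_def)
  interpret prob_space P
    using P by (simp add: hmm_law_def)
  let ?K = "\<lambda>\<omega>. cond_kernel M g (snd \<omega>)"
  have "snd -` H' \<inter> space P \<in> sets P"
    using H'(1) by (intro measurable_sets[of snd P OmegaY])
      (simp_all add: measurable_cong_sets[OF sets_P refl] Omega_def)
  then have "{\<omega> \<in> space P. snd \<omega> \<in> H'} \<in> sets P"
    by (simp add: vimage_def Int_def conj_commute)
  then have "AE \<omega> in P. snd \<omega> \<in> H'"
    using H'(2) by (simp add: prob_Collect_eq_1)
  moreover have "AE \<omega> in P. \<forall>(n, x)\<in>{..0} \<times> UNIV.
      (\<Sum>x'\<in>UNIV. pmf (\<mu> (n - 1) (snd \<omega>)) x' * pmf (?K \<omega> n x') x) = pmf (\<mu> n (snd \<omega>)) x"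
    using mu_absolute by (subst AE_ball_countable) (auto intro!: countable_SIGMA countable_finite)
  \<comment> \<open>For almost every \<open>\<omega>\<close> the kernel \<open>PX\<close> provides a Markov law for the conditional kernels, with one-time laws
    \<open>\<mu>\<close>, so that the equivalence holds pointwise.\<close>
  ultimately have iff: "AE \<omega> in P. ?C \<omega> \<longleftrightarrow> ?T \<omega>"
    using AE_space
  proof eventually_elim
    case (elim \<omega>)
    then have "(\<lambda>n. \<mu> n (snd \<omega>)) \<in> absolute_probs (?K \<omega>)"
      by (auto simp: absolute_probs_def)
    moreover have "snd \<omega> \<in> space OmegaY"
      using elim sets_eq_imp_space_eq[OF sets_P] by (auto simp: space_Omega)
    then have "PX (snd \<omega>) \<in> space (prob_algebra OmegaX)"
      using PX_kernel by (rule measurable_space[rotated])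
    then have "is_markov_law (?K \<omega>) (\<lambda>n. \<mu> n (snd \<omega>)) (PX (snd \<omega>))"
      using PX_fdd[of "snd \<omega>"] elim by (simp add: is_markov_law_def space_prob_algebra)
    ultimately show ?case
      unfolding coalescing_def[symmetric] by (rule coalescing_iff_tail)
  qed
  show ?thesis
  proof
    assume "AE \<omega> in P. ?C \<omega>"
    with iff have "AE \<omega> in P. ?T \<omega>"
      by eventually_elim (rule iffD1)
    then obtain H where H: "H \<subseteq> {\<omega> \<in> space P. ?T \<omega>}" "H \<in> sets P" "measure P H = 1"
      by (rule AE_E_prob)
    have "?T \<omega>" if "\<omega> \<in> H" for \<omega>
      using subsetD[OF H(1) that] unfolding mem_Collect_eq by (rule conjunct2)
    then show "\<exists>H\<in>sets P. measure P H = 1 \<and> (\<forall>\<omega>\<in>H. ?T \<omega>)"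
      by (intro bexI[OF _ H(2)] conjI[OF H(3)] ballI[of H])
  next
    assume "\<exists>H\<in>sets P. measure P H = 1 \<and> (\<forall>\<omega>\<in>H. ?T \<omega>)"
    then obtain H where H: "H \<in> sets P" "measure P H = 1" "\<And>\<omega>. \<omega> \<in> H \<Longrightarrow> ?T \<omega>"
      by blast
    from AE_prob_1[OF H(2)] iff show "AE \<omega> in P. ?C \<omega>"
      by eventually_elim (rule iffD2, assumption, rule H(3))
  qed
qed

end
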